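(* Let $w\in S_n$ with $\ell(w)=n-1$. Then there exists a sequence of positive integers $(i_1,\dots,i_{n-1})$ with $i_j\le j$ for all $j$ such that the integer $T_{i_1}T_{i_2}\cdots T_{i_{n-1}}\mathfrak S_w$ is strictly positive. In particular $\langle\mathfrak S_w\rangle_n>0$.
   Context: $R_if=f(x_1,\dots,x_{i-1},0,x_i,\dots)$, $T_if=\frac1{x_i}(R_{i+1}f-R_if)$, composed right to left. Schubert polynomials $\mathfrak S_w$: $\mathfrak S_{\mathrm{id}}=1$, $\partial_i\mathfrak S_w=\mathfrak S_{ws_i}$ if $w(i)>w(i+1)$ and $0$ otherwise, homogeneous of degree $\ell(w)$, and $\mathfrak S_w\in\mathbb Z[x_1,\dots,x_n]$ for $w\in S_n$. Divided symmetrization: $\langle f\rangle_n=\sum_{\sigma\in S_n}\frac{f(x_{\sigma(1)},\dots,x_{\sigma(n)})}{(x_{\sigma(1)}-x_{\sigma(2)})\cdots(x_{\sigma(n-1)}-x_{\sigma(n)})}$. *)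

theory Defs
  imports Complex_Main "HOL-Combinatorics.Permutations"
begin

text \<open>Polynomials in the variables x_1, x_2, ... with integer coefficients are represented
by their coefficient functions: a monomial is an exponent vector m :: nat => nat
(m j = exponent of x_j; index 0 is unused), a polynomial is c :: (nat => nat) => int.\<close>

type_synonym monom = "nat \<Rightarrow> nat"
type_synonym ipoly = "monom \<Rightarrow> int"

definition mdeg :: "monom \<Rightarrow> nat" where
  "mdeg m = (\<Sum>j\<in>{j. m j \<noteq> 0}. m j)"

definition pone :: ipoly where
  "pone m = (if m = (\<lambda>_. 0) then 1 else 0)"

definition peval :: "ipoly \<Rightarrow> (nat \<Rightarrow> real) \<Rightarrow> real" where
  "peval c x = (\<Sum>m\<in>{m. c m \<noteq> 0}. of_int (c m) * (\<Prod>j\<in>{j. m j \<noteq> 0}. x j ^ m j))"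

definition swapm :: "nat \<Rightarrow> monom \<Rightarrow> monom" where
  "swapm i m j = (if j = i then m (Suc i) else if j = Suc i then m i else m j)"

definition psw :: "nat \<Rightarrow> ipoly \<Rightarrow> ipoly" where
  "psw i c m = c (swapm i m)"

text \<open>Multiplication by (x_i - x_{i+1}).\<close>
definition pmuld :: "nat \<Rightarrow> ipoly \<Rightarrow> ipoly" where
  "pmuld i g m =
     (if 0 < m i then g (m(i := m i - 1)) else 0)
   - (if 0 < m (Suc i) then g (m(Suc i := m (Suc i) - 1)) else 0)"

text \<open>R_i f = f(x_1,...,x_{i-1},0,x_i,...).\<close>
definition ins0 :: "nat \<Rightarrow> monom \<Rightarrow> monom" where
  "ins0 i m j = (if j < i then m j else if j = i then 0 else m (j - 1))"

definition Rop :: "nat \<Rightarrow> ipoly \<Rightarrow> ipoly" where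
  "Rop i c m = c (ins0 i m)"

text \<open>T_i f = (R_{i+1} f - R_i f) / x_i (an exact division).\<close>
definition Top :: "nat \<Rightarrow> ipoly \<Rightarrow> ipoly" where
  "Top i c m = Rop (Suc i) c (m(i := Suc (m i))) - Rop i c (m(i := Suc (m i)))"

definition finperm :: "(nat \<Rightarrow> nat) \<Rightarrow> bool" where
  "finperm w \<longleftrightarrow> (\<exists>N. w permutes {1..N})"

definition plength :: "(nat \<Rightarrow> nat) \<Rightarrow> nat" where
  "plength w = card {(i, j). i < j \<and> w j < w i}"

definition sref :: "nat \<Rightarrow> nat \<Rightarrow> nat" where
  "sref i j = (if j = i then Suc i else if j = Suc i then i else j)"

definition schubert_family :: "((nat \<Rightarrow> nat) \<Rightarrow> ipoly) \<Rightarrow> bool" where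
  "schubert_family S \<longleftrightarrow>
     S id = pone \<and>
     (\<forall>w i. finperm w \<and> 1 \<le> i \<longrightarrow>
        S w - psw i (S w) = pmuld i (if w (Suc i) < w i then S (w \<circ> sref i) else (\<lambda>_. 0))) \<and>
     (\<forall>w m. finperm w \<and> S w m \<noteq> 0 \<longrightarrow> finite {j. m j \<noteq> 0} \<and> mdeg m = plength w) \<and>
     (\<forall>w n m. w permutes {1..n} \<and> S w m \<noteq> 0 \<longrightarrow> (\<forall>j. m j \<noteq> 0 \<longrightarrow> j \<in> {1..n}))"

definition schubert :: "(nat \<Rightarrow> nat) \<Rightarrow> ipoly" where
  "schubert = (SOME S. schubert_family S)"

definition divsym :: "nat \<Rightarrow> ipoly \<Rightarrow> (nat \<Rightarrow> real) \<Rightarrow> real" where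
  "divsym n f x = (\<Sum>\<sigma>\<in>{\<sigma>. \<sigma> permutes {1..n}}.
      peval f (\<lambda>j. x (\<sigma> j)) / (\<Prod>k\<in>{1..<n}. (x (\<sigma> k) - x (\<sigma> (Suc k)))))"

end

theory Submission
  imports Defs "HOL-Library.Function_Algebras"
begin

text \<open>Write \<open>u\<^sub>i = x\<^sub>1 + \<dots> + x\<^sub>i\<close> and let \<open>L\<close> be the sum of \<open>T\<close>-sequences
  \<open>T\<^bsub>i\<^sub>1\<^esub> \<dots> T\<^bsub>i\<^sub>n\<^sub>-\<^sub>1\<^esub>\<close> with \<open>i\<^sub>j \<le> j\<close>. Inserting \<open>x\<^sub>n\<close> at every position of the permutations of the
  remaining variables and using partial fractions shows by induction that \<open>L\<close> is divided
  symmetrization in degree \<open>n - 1\<close>, so everything follows from \<open>L \<SS>\<^sub>w > 0\<close>.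

  \<open>L\<close> annihilates all multiples of \<open>u\<^sub>n\<close> and of \<open>u\<^sub>i (x\<^sub>i - x\<^sub>i\<^sub>+\<^sub>1)\<close>. Modulo these, \<open>\<Sum>i. u\<^sub>i \<partial>\<^sub>i\<close> is a
  derivation fixing every variable, hence multiplies by the degree (Klyachko); iterating,
  \<open>(n - 1)! L \<SS>\<^sub>w\<close> is the sum of \<open>L (u\<^bsub>i\<^sub>1\<^esub> \<dots> u\<^bsub>i\<^sub>n\<^sub>-\<^sub>1\<^esub>)\<close> over the reduced words of \<open>w\<close>. Each such term is
  positive: a repeated factor \<open>u\<^sub>t\<close> satisfies \<open>2 u\<^sub>t\<^sup>2 = u\<^sub>t (u\<^sub>t\<^sub>-\<^sub>1 + u\<^sub>t\<^sub>+\<^sub>1)\<close>, and a discrete minimum principle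
  reduces to \<open>L (u\<^sub>1 \<dots> u\<^sub>n\<^sub>-\<^sub>1) = (n - 1)!\<close>.

  That a Schubert family exists at all is shown by solving \<open>f = R\<^sub>1 f + (\<Sum>i. x\<^sub>i R\<^sub>i \<partial>\<^sub>i f)\<close>, an identity
  valid for every polynomial, recursively along descents.\<close>

section \<open>Operators on coefficient functions\<close>

definition mulx :: "nat \<Rightarrow> ipoly \<Rightarrow> ipoly" where
  "mulx j f m = (if 0 < m j then f (m(j := m j - 1)) else 0)"

lemma pmuld_mulx: "pmuld i g = mulx i g - mulx (Suc i) g"
  by (auto simp: fun_eq_iff pmuld_def mulx_def)

interpretation mulx: additive "mulx j" for j
  by standard (auto simp: fun_eq_iff mulx_def)

interpretation Rop: additive "Rop i" for i
  by standard (auto simp: fun_eq_iff Rop_def)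

interpretation Top: additive "Top i" for i
  by standard (auto simp: fun_eq_iff Top_def Rop_def)

interpretation psw: additive "psw i" for i
  by standard (auto simp: fun_eq_iff psw_def)

interpretation pmuld: additive "pmuld i" for i
  by standard (simp add: pmuld_mulx mulx.add)

lemma mulx_commute: "mulx i (mulx j f) = mulx j (mulx i f)"
  by (cases "i = j") (auto simp: fun_eq_iff mulx_def fun_upd_twist)

text \<open>Identities for \<open>Top\<close> are proved after multiplication by a variable, which
  turns its exact division into a subtraction.\<close>

lemma mulx_cancel:
  assumes "mulx j f = mulx j g"
  shows "f = g"
proof
  fix m
  have "mulx j f (m(j := Suc (m j))) = mulx j g (m(j := Suc (m j)))"
    using assms by simp
  then show "f m = g m" by (simp add: mulx_def)
qed

text \<open>Comparing coefficients shows that moving one unit of exponent from x_{i+1} to x_i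
  preserves the coefficient of g; once x_{i+1} is exhausted, the coefficient is 0.\<close>

lemma pmuld_eq_0:
  assumes "pmuld i g = 0"
  shows "g = 0"
proof
  have step: "g m = (if 0 < m (Suc i) then g (m(i := Suc (m i), Suc i := m (Suc i) - 1)) else 0)" for m
  proof -
    have "pmuld i g (m(i := Suc (m i))) = 0" using assms by simp
    then show ?thesis by (simp add: pmuld_def fun_upd_twist split: if_splits)
  qed
  have "\<forall>m. m (Suc i) = b \<longrightarrow> g m = 0" for b
  proof (induction b)
    case 0
    then show ?case using step by simp
  next
    case (Suc b)
    show ?case
    proof (intro allI impI)
      fix m :: monom assume "m (Suc i) = Suc b"
      then show "g m = 0" using Suc step[of m] by simp
    qed
  qed
  then show "g m = 0 m" for m by simp
qed

lemma pmuld_cancel: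
  assumes "pmuld i f = pmuld i g"
  shows "f = g"
  using pmuld_eq_0[of i "f - g"] assms by (simp add: pmuld.diff)

lemma ins0_upd_less: "j < i \<Longrightarrow> (ins0 i m)(j := v) = ins0 i (m(j := v))"
  by (auto simp: fun_eq_iff ins0_def)

lemma ins0_upd_ge: "i \<le> j \<Longrightarrow> (ins0 i m)(Suc j := v) = ins0 i (m(j := v))"
  by (auto simp: fun_eq_iff ins0_def)

lemma Rop_mulx_less: "j < i \<Longrightarrow> Rop i (mulx j f) = mulx j (Rop i f)"
  by (auto simp: fun_eq_iff Rop_def mulx_def ins0_upd_less)
     (auto simp: ins0_def)

lemma Rop_mulx_same [simp]: "Rop i (mulx i f) = 0"
  by (auto simp: fun_eq_iff Rop_def mulx_def ins0_def)

lemma Rop_mulx_ge: "i \<le> j \<Longrightarrow> Rop i (mulx (Suc j) f) = mulx j (Rop i f)"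
  by (auto simp: fun_eq_iff Rop_def mulx_def ins0_upd_ge)
     (auto simp: ins0_def)

text \<open>The division by x_i is exact: where x_i has exponent 0, inserting a 0 at i or at i+1
  gives the same exponent vector, so the two coefficients cancel.\<close>

lemma mulx_Top: "mulx i (Top i f) = Rop (Suc i) f - Rop i f"
proof
  fix m
  have "m i = 0 \<Longrightarrow> ins0 (Suc i) m = ins0 i m"
    by (auto simp: fun_eq_iff ins0_def less_Suc_eq)
  then show "mulx i (Top i f) m = (Rop (Suc i) f - Rop i f) m"
    by (auto simp: mulx_def Top_def Rop_def)
qed

lemma psw_psw [simp]: "psw i (psw i f) = f"
  by (auto simp: fun_eq_iff psw_def swapm_def intro!: arg_cong[where f = f])

lemma psw_mulx:
  "psw i (mulx i f) = mulx (Suc i) (psw i f)"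
  "psw i (mulx (Suc i) f) = mulx i (psw i f)"
  "j \<noteq> i \<Longrightarrow> j \<noteq> Suc i \<Longrightarrow> psw i (mulx j f) = mulx j (psw i f)"
  by (auto simp: fun_eq_iff psw_def swapm_def mulx_def intro!: arg_cong[where f = f])

lemma psw_Rop:
  "Suc j < i \<Longrightarrow> psw j (Rop i f) = Rop i (psw j f)"
  "i \<le> j \<Longrightarrow> psw j (Rop i f) = Rop i (psw (Suc j) f)"
  by (rule ext, auto simp: psw_def swapm_def Rop_def ins0_def fun_eq_iff intro!: arg_cong[where f = f])+

lemma Rop_psw: "Rop i (psw i f) = Rop (Suc i) f"
  by (rule ext, auto simp: psw_def swapm_def Rop_def ins0_def fun_eq_iff less_Suc_eq intro!: arg_cong[where f = f])

section \<open>Divided differences\<close>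

definition dd :: "nat \<Rightarrow> ipoly \<Rightarrow> ipoly" where
  "dd i f m = (\<Sum>k\<le>m (Suc i). (f - psw i f) (m(i := m i + 1 + k, Suc i := m (Suc i) - k)))"

text \<open>\<open>dd\<close> expands 1/(x_i - x_{i+1}) as a geometric series in x_{i+1}/x_i.
  Multiplying back telescopes to the coefficient at (a, b) when a > 0; when a = 0, a sum over the
  whole antidiagonal enters, and it vanishes because f - s_i f is antisymmetric.\<close>

lemma pmuld_dd: "pmuld i (dd i f) = f - psw i f"
proof
  fix m
  define a b :: nat where "a = m i" and "b = m (Suc i)"
  define h where "h p q = (f - psw i f) (m(i := p, Suc i := q))" for p q :: nat
  have anti: "h q p = - h p q" for p q :: nat
  proof -
    have "swapm i (m(i := p, Suc i := q)) = m(i := q, Suc i := p)" for p q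
      by (auto simp: fun_eq_iff swapm_def)
    then show ?thesis by (simp add: h_def psw_def)
  qed
  have h0: "(f - psw i f) m = h a b"
    unfolding h_def a_def b_def by simp
  have dd1: "dd i f (m(i := p, Suc i := q)) = (\<Sum>k\<le>q. h (p + 1 + k) (q - k))" for p q
    unfolding dd_def h_def by (simp add: fun_upd_twist)
  have d1: "dd i f (m(i := a - 1)) = (\<Sum>k\<le>b. h (a - 1 + 1 + k) (b - k))"
    using dd1[of "a - 1" b] by (simp add: b_def fun_upd_idem)
  have d2: "dd i f (m(Suc i := b - 1)) = (\<Sum>k\<le>b-1. h (a + 1 + k) (b - 1 - k))"
    using dd1[of a "b - 1"] unfolding a_def by simp
  have split1: "(\<Sum>k\<le>b. h (a + k) (b - k)) = h a b + (\<Sum>k\<le>b-1. h (a + 1 + k) (b - 1 - k))" if pos: "b > 0"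
  proof -
    obtain c where "b = Suc c" using pos gr0_conv_Suc by blast
    then show ?thesis by (simp add: sum.atMost_Suc_shift del: sum.atMost_Suc)
  qed
  have antisum: "(\<Sum>k\<le>b. h k (b - k)) = 0"
  proof -
    have "(\<Sum>k\<le>b. h k (b - k)) = (\<Sum>k\<le>b. h (b - k) k)"
      by (rule sum.reindex_bij_witness[of _ "\<lambda>k. b - k" "\<lambda>k. b - k"]) auto
    also have "\<dots> = - (\<Sum>k\<le>b. h k (b - k))"
      by (simp add: anti[of "b - _"] sum_negf)
    finally show ?thesis by simp
  qed
  have "pmuld i (dd i f) m = (if 0 < a then (\<Sum>k\<le>b. h (a + k) (b - k)) else 0)
      - (if 0 < b then (\<Sum>k\<le>b-1. h (a + 1 + k) (b - 1 - k)) else 0)"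
    unfolding pmuld_def a_def[symmetric] b_def[symmetric] d1 d2 by simp
  also have "\<dots> = h a b"
  proof (cases "a = 0")
    case False
    then show ?thesis using split1 by auto
  next
    case True
    have "h 0 0 = 0" using anti[of 0 0] by simp
    then show ?thesis using True split1 antisum by (cases "b = 0") auto
  qed
  finally show "pmuld i (dd i f) m = (f - psw i f) m" using h0 by simp
qed

lemma dd_unique: "pmuld i g = f - psw i f \<Longrightarrow> dd i f = g"
  using pmuld_dd pmuld_cancel by metis

interpretation dd: additive "dd i" for i
  by standard (rule dd_unique, simp add: pmuld.add pmuld_dd psw.add)

lemma dd_eq_0_iff: "dd i f = 0 \<longleftrightarrow> psw i f = f"
proof
  assume "dd i f = 0"
  then show "psw i f = f" using pmuld_dd[of i f] by (simp add: pmuld.zero)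
qed (rule dd_unique, simp add: pmuld.zero)

lemma psw_pmuld:
  "psw i (pmuld i f) = - pmuld i (psw i f)"
  by (simp add: pmuld_mulx psw.diff psw_mulx)

lemma psw_dd [simp]: "psw i (dd i f) = dd i f"
proof (rule pmuld_cancel)
  have "pmuld i (psw i (dd i f)) = - psw i (pmuld i (dd i f))"
    by (simp add: psw_pmuld)
  also have "\<dots> = pmuld i (dd i f)"
    by (simp add: pmuld_dd psw.diff)
  finally show "pmuld i (psw i (dd i f)) = pmuld i (dd i f)" .
qed

lemma dd_mulx:
  "j \<noteq> i \<Longrightarrow> j \<noteq> Suc i \<Longrightarrow> dd i (mulx j f) = mulx j (dd i f)"
  "dd i (mulx i f) = f + mulx (Suc i) (dd i f)"
  "dd i (mulx (Suc i) f) = mulx i (dd i f) - f"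
proof -
  have s: "psw i f = f - pmuld i (dd i f)" by (simp add: pmuld_dd)
  show "j \<noteq> i \<Longrightarrow> j \<noteq> Suc i \<Longrightarrow> dd i (mulx j f) = mulx j (dd i f)"
    by (rule dd_unique) (simp add: psw_mulx s pmuld_mulx mulx.diff mulx_commute)
  show "dd i (mulx i f) = f + mulx (Suc i) (dd i f)"
    by (rule dd_unique) (simp add: psw_mulx s pmuld_mulx mulx.diff mulx.add mulx_commute algebra_simps)
  show "dd i (mulx (Suc i) f) = mulx i (dd i f) - f"
    by (rule dd_unique) (simp add: psw_mulx s pmuld_mulx mulx.diff mulx.add mulx_commute algebra_simps)
qed

lemma dd_Rop:
  "Suc j < i \<Longrightarrow> dd j (Rop i f) = Rop i (dd j f)"
  "i \<le> j \<Longrightarrow> dd j (Rop i f) = Rop i (dd (Suc j) f)"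
proof -
  assume "Suc j < i"
  then show "dd j (Rop i f) = Rop i (dd j f)"
    by (intro dd_unique)
      (simp add: psw_Rop pmuld_mulx flip: Rop_mulx_less Rop.diff, simp add: pmuld_dd flip: pmuld_mulx)
next
  assume "i \<le> j"
  then show "dd j (Rop i f) = Rop i (dd (Suc j) f)"
    by (intro dd_unique)
      (simp add: psw_Rop pmuld_mulx flip: Rop_mulx_ge Rop.diff, simp add: pmuld_dd flip: pmuld_mulx)
qed

text \<open>Apply \<open>Rop i\<close> to \<open>pmuld i (dd i f) = f - psw i f\<close>: it kills
  x_i and turns x_{i+1} into x_i. Trimming is thus a divided difference followed by the insertion of
  0.\<close>

lemma Top_eq_Rop_dd: "Top i f = Rop i (dd i f)"
proof (rule mulx_cancel)
  have "Rop i (pmuld i (dd i f)) = Rop i f - Rop (Suc i) f"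
    by (simp add: pmuld_dd Rop.diff Rop_psw)
  then have "mulx i (Rop i (dd i f)) = Rop (Suc i) f - Rop i f"
    by (simp add: pmuld_mulx Rop.diff Rop_mulx_ge algebra_simps)
  then show "mulx i (Top i f) = mulx i (Rop i (dd i f))" by (simp add: mulx_Top)
qed

lemma Rop_dd_Suc: "Rop (Suc i) (dd i f) = Rop i (dd i f)"
  using Rop_psw[of i "dd i f"] by simp

text \<open>Telescopes R_{i+1} f - R_i f = x_i T_i f. With a = 1 and b beyond the last variable,
  where R_b f = f, it recovers f from R_1 f and the divided differences.\<close>

lemma Rop_diff_eq_sum:
  "a \<le> b \<Longrightarrow> Rop b f - Rop a f = (\<Sum>i=a..<b. mulx i (Rop i (dd i f)))"
proof (induction b rule: dec_induct)
  case (step b)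
  have "Rop (Suc b) f - Rop a f = (Rop b f - Rop a f) + mulx b (Rop b (dd b f))"
    using mulx_Top[of b f] unfolding Top_eq_Rop_dd by simp
  then show ?case
    using step by simp
qed auto

section \<open>Existence of Schubert polynomials\<close>

definition vars :: "nat \<Rightarrow> ipoly \<Rightarrow> bool" where
  "vars n f \<longleftrightarrow> (\<forall>m. f m \<noteq> 0 \<longrightarrow> (\<forall>j. m j \<noteq> 0 \<longrightarrow> j \<in> {1..n}))"

definition homog :: "nat \<Rightarrow> ipoly \<Rightarrow> bool" where
  "homog d f \<longleftrightarrow> (\<forall>m. f m \<noteq> 0 \<longrightarrow> finite {j. m j \<noteq> 0} \<and> mdeg m = d)"

lemma vars_0 [simp]: "vars n 0" and homog_0 [simp]: "homog d 0"
  by (auto simp: vars_def homog_def)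

lemma vars_mono: "vars n f \<Longrightarrow> n \<le> N \<Longrightarrow> vars N f"
  unfolding vars_def by (meson atLeastAtMost_iff order_trans)

lemma vars_eq_0: "vars n f \<Longrightarrow> m j \<noteq> 0 \<Longrightarrow> n < j \<Longrightarrow> f m = 0"
  unfolding vars_def by (meson atLeastAtMost_iff not_le)

lemma vars_add: "vars n f \<Longrightarrow> vars n g \<Longrightarrow> vars n (f + g)"
  unfolding vars_def by (metis add.right_neutral plus_fun_apply)

lemma homog_add: "homog n f \<Longrightarrow> homog n g \<Longrightarrow> homog n (f + g)"
  unfolding homog_def by (metis add.right_neutral plus_fun_apply)

lemma vars_sum: "(\<And>i. i \<in> A \<Longrightarrow> vars n (f i)) \<Longrightarrow> vars n (\<Sum>i\<in>A. f i)"
  by (induction A rule: infinite_finite_induct) (auto intro: vars_add)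

lemma homog_sum: "(\<And>i. i \<in> A \<Longrightarrow> homog n (f i)) \<Longrightarrow> homog n (\<Sum>i\<in>A. f i)"
  by (induction A rule: infinite_finite_induct) (auto intro: homog_add)

lemma vars_mulx:
  assumes "vars n f" "j \<in> {1..n}"
  shows "vars n (mulx j f)"
  unfolding vars_def
proof (intro allI impI)
  fix m i assume a: "mulx j f m \<noteq> 0" "m i \<noteq> 0"
  show "i \<in> {1..n}"
  proof (cases "i = j")
    case False
    then have "(m(j := m j - 1)) i \<noteq> 0" using a by simp
    moreover have "f (m(j := m j - 1)) \<noteq> 0" using a by (simp add: mulx_def split: if_splits)
    ultimately show ?thesis using assms(1) unfolding vars_def by blast
  qed (use assms in simp)
qed

lemma ins0_Suc: "i \<le> j \<Longrightarrow> ins0 i m (Suc j) = m j"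
  by (simp add: ins0_def)

lemma vars_Rop:
  assumes "vars n f" "1 \<le> i"
  shows "vars n (Rop i f)"
  unfolding vars_def
proof (intro allI impI)
  fix m j assume a: "Rop i f m \<noteq> 0" "m j \<noteq> 0"
  then have *: "\<And>k. ins0 i m k \<noteq> 0 \<Longrightarrow> k \<in> {1..n}" using assms(1)
    unfolding vars_def Rop_def by blast
  show "j \<in> {1..n}"
    using *[of j] *[of "Suc j"] a(2) assms(2) by (cases "j < i") (auto simp: ins0_def)
qed

lemma vars_Rop1:
  assumes "vars (Suc n) f"
  shows "vars n (Rop 1 f)"
  unfolding vars_def
proof (intro allI impI)
  fix m j assume a: "Rop 1 f m \<noteq> 0" "m j \<noteq> 0"
  then have *: "\<And>k. ins0 1 m k \<noteq> 0 \<Longrightarrow> k \<in> {1..Suc n}" using assms(1)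
    unfolding vars_def Rop_def by blast
  show "j \<in> {1..n}"
    using *[of j] *[of "Suc j"] a(2) by (cases "j < 1") (auto simp: ins0_def)
qed

lemma Rop_eq_self:
  assumes "vars n f" "n < i"
  shows "Rop i f = f"
proof
  fix m
  show "Rop i f m = f m"
  proof (cases "\<forall>j\<ge>i. m j = 0")
    case True
    then have "ins0 i m = m" by (auto simp: ins0_def fun_eq_iff)
    then show ?thesis by (simp add: Rop_def)
  next
    case False
    then obtain j where j: "j \<ge> i" "m j \<noteq> 0" by auto
    then have "f m = 0" using vars_eq_0[OF assms(1)] assms(2) by simp
    moreover have "f (ins0 i m) = 0"
    proof (rule ccontr)
      assume "f (ins0 i m) \<noteq> 0"
      then have "Suc j \<in> {1..n}" using assms j unfolding vars_def by (metis ins0_Suc)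
      then show False using j assms by simp
    qed
    ultimately show ?thesis by (simp add: Rop_def)
  qed
qed

lemma mdeg_eq_sum:
  assumes "finite A" "\<And>j. m j \<noteq> 0 \<Longrightarrow> j \<in> A"
  shows "mdeg m = (\<Sum>j\<in>A. m j)"
  unfolding mdeg_def using assms by (intro sum.mono_neutral_left) auto

lemma mdeg_upd:
  assumes "finite {j. m j \<noteq> 0}"
  shows "finite {j. (m(i := v)) j \<noteq> 0}" "mdeg (m(i := v)) + m i = mdeg m + v"
proof -
  let ?A = "insert i {j. m j \<noteq> 0}"
  have sub: "{j. (m(i := v)) j \<noteq> 0} \<subseteq> ?A" by auto
  then show "finite {j. (m(i := v)) j \<noteq> 0}"
    by (rule finite_subset) (use assms in simp)
  have fin: "finite ?A" using assms by simp
  have "mdeg m = (\<Sum>j\<in>?A. m j)" "mdeg (m(i := v)) = (\<Sum>j\<in>?A. (m(i := v)) j)"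
    by (rule mdeg_eq_sum; use fin in \<open>auto split: if_splits\<close>)+
  moreover have "(\<Sum>j\<in>?A. m j) = m i + (\<Sum>j\<in>?A - {i}. m j)"
    "(\<Sum>j\<in>?A. (m(i := v)) j) = v + (\<Sum>j\<in>?A - {i}. m j)"
    using assms by (simp_all add: sum.insert_remove)
  ultimately show "mdeg (m(i := v)) + m i = mdeg m + v" by simp
qed

lemma ins0_support: "{j. ins0 i m j \<noteq> 0} = (\<lambda>j. if j < i then j else Suc j) ` {j. m j \<noteq> 0}"
proof -
  have "j \<in> (\<lambda>j. if j < i then j else Suc j) ` {j. m j \<noteq> 0}" if "ins0 i m j \<noteq> 0" for j
    using that by (intro image_eqI[of _ _ "if j < i then j else j - 1"]) (auto simp: ins0_def split: if_splits)
  then have "{j. ins0 i m j \<noteq> 0} \<subseteq> (\<lambda>j. if j < i then j else Suc j) ` {j. m j \<noteq> 0}" by blast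
  moreover have "(\<lambda>j. if j < i then j else Suc j) ` {j. m j \<noteq> 0} \<subseteq> {j. ins0 i m j \<noteq> 0}"
    by (auto simp: ins0_def)
  ultimately show ?thesis by blast
qed

lemma inj_ins0_shift: "inj_on (\<lambda>j. if j < i then j else Suc j) A" for i :: nat
  by (auto simp: inj_on_def split: if_splits)

lemma finite_ins0_support [simp]: "finite {j. ins0 i m j \<noteq> 0} \<longleftrightarrow> finite {j. m j \<noteq> 0}"
  unfolding ins0_support using inj_ins0_shift finite_image_iff by blast

lemma mdeg_ins0 [simp]: "mdeg (ins0 i m) = mdeg m"
  unfolding mdeg_def ins0_support
  by (subst sum.reindex[OF inj_ins0_shift]) (auto simp: ins0_def intro!: sum.cong)

lemma homog_Rop: "homog d f \<Longrightarrow> homog d (Rop i f)"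
  unfolding homog_def Rop_def by (metis finite_ins0_support mdeg_ins0)

lemma homog_mulx:
  assumes "homog d f"
  shows "homog (Suc d) (mulx i f)"
  unfolding homog_def
proof (intro allI impI)
  fix m assume "mulx i f m \<noteq> 0"
  then have *: "m i > 0" "f (m(i := m i - 1)) \<noteq> 0"
    by (auto simp: mulx_def split: if_splits)
  define m' where "m' = m(i := m i - 1)"
  then have **: "finite {j. m' j \<noteq> 0}" "mdeg m' = d"
    using assms *(2) unfolding homog_def by blast+
  have "m = m'(i := m i)" "m' i = m i - 1" by (auto simp: m'_def)
  then show "finite {j. m j \<noteq> 0} \<and> mdeg m = Suc d"
    using mdeg_upd[OF **(1), of i "m i"] **(2) *(1) by auto
qed

lemma psw_eq_self:
  assumes "vars n f" "n < i"
  shows "psw i f = f"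
proof
  fix m
  show "psw i f m = f m"
  proof (cases "m i = 0 \<and> m (Suc i) = 0")
    case True
    then have "swapm i m = m" by (auto simp: swapm_def fun_eq_iff)
    then show ?thesis by (simp add: psw_def)
  next
    case False
    note vars_eq_0[OF assms(1)]
    moreover have "swapm i m i = m (Suc i)" "swapm i m (Suc i) = m i" by (auto simp: swapm_def)
    ultimately have "f m = 0 \<and> f (swapm i m) = 0"
      using False assms(2) by (metis less_Suc_eq not_less_eq)
    then show ?thesis by (simp add: psw_def)
  qed
qed

lemma dd_eq_0_of_vars: "vars n f \<Longrightarrow> n < i \<Longrightarrow> dd i f = 0"
  by (simp add: dd_eq_0_iff psw_eq_self)

text \<open>The key is \<open>g j = Rop 1 (g (Suc j)) + dd j F\<close> for \<open>F = (\<Sum>i. x\<^sub>i R\<^sub>i g\<^sub>i)\<close>, which follows by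
  expanding both \<open>g j\<close> and \<open>Rop 1 (g (Suc j))\<close> along the telescoping sum \<open>Rop_diff_eq_sum\<close>.\<close>

lemma dd_integrable:
  assumes vg: "\<And>i. vars N (g i)" and g0: "\<And>i. N < i \<Longrightarrow> g i = 0"
    and diag: "\<And>i. 1 \<le> i \<Longrightarrow> dd i (g i) = 0"
    and far: "\<And>i j. 1 \<le> i \<Longrightarrow> Suc i < j \<Longrightarrow> dd i (g j) = dd j (g i)"
    and braid: "\<And>i. 1 \<le> i \<Longrightarrow> dd i (dd (Suc i) (g i)) = dd (Suc i) (dd i (g (Suc i)))"
    and vf: "vars N f" and f: "f = Rop 1 f + (\<Sum>i=1..N. mulx i (Rop i (g i)))"
    and "1 \<le> j"
  shows "dd j f = g j"
proof -
  define F where "F = (\<Sum>i=1..N. mulx i (Rop i (g i)))"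
  have key: "g j = Rop 1 (g (Suc j)) + dd j F" if "1 \<le> j" for j
  proof -
    \<comment> \<open>The range is padded with zero terms so that it contains j and j+1; moreover
      \<open>Suc M\<close> exceeds N, so \<open>Rop (Suc M)\<close> fixes
      \<open>g j\<close>.\<close>
    define M where "M = N + j + 1"
    define X where "X = (\<lambda>i h. mulx i (Rop i h))"
    have Xadd: "X i (a + b) = X i a + X i b" for i a b
      by (simp add: X_def Rop.add mulx.add)
    have S: "{1..M} = {1..<j} \<union> {j, Suc j} \<union> {Suc (Suc j)..M}"
      using that M_def by auto
    have split: "(\<Sum>i=1..M. h i) = (\<Sum>i=1..<j. h i) + (h j + h (Suc j)) + (\<Sum>i=Suc (Suc j)..M. h i)"
      for h :: "nat \<Rightarrow> ipoly"
      unfolding S by (subst sum.union_disjoint; (subst sum.union_disjoint)?; auto)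
    have "F = (\<Sum>i=1..M. X i (g i))"
      unfolding F_def X_def M_def
      by (rule sum.mono_neutral_left) (auto simp: g0 Rop.zero mulx.zero)
    then have "dd j F = (\<Sum>i=1..M. dd j (X i (g i)))" by (simp add: dd.sum)
    also have "\<dots> = (\<Sum>i=1..<j. dd j (X i (g i))) + (dd j (X j (g j)) + dd j (X (Suc j) (g (Suc j))))
        + (\<Sum>i=Suc (Suc j)..M. dd j (X i (g i)))"
      by (rule split)
    \<comment> \<open>For i < j, \<open>dd j\<close> becomes \<open>dd (Suc j)\<close> when it
      passes \<open>Rop i\<close>; the commutation hypothesis then applies, since i and j+1 are not
      adjacent.\<close>
    also have "(\<Sum>i=1..<j. dd j (X i (g i))) = (\<Sum>i=1..<j. X i (dd i (g (Suc j))))"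
      using far[of _ "Suc j"] by (intro sum.cong) (auto simp: X_def dd_mulx dd_Rop)
    also have "(\<Sum>i=Suc (Suc j)..M. dd j (X i (g i))) = (\<Sum>i=Suc (Suc j)..M. X i (dd i (g j)))"
      using that by (intro sum.cong) (auto simp: X_def dd_mulx dd_Rop far)
    also have "dd j (X j (g j)) = Rop j (g j) + mulx (Suc j) (Rop j (dd (Suc j) (g j)))"
      by (simp add: X_def dd_mulx dd_Rop)
    \<comment> \<open>\<open>dd j\<close> does not pass \<open>Rop (Suc j)\<close>, but by
      \<open>diag\<close> the polynomial \<open>g (Suc j)\<close> is symmetric in x_{j+1} and
      x_{j+2}, so the 0 may be inserted one place later, where \<open>dd j\<close> passes.\<close>
    also have "dd j (X (Suc j) (g (Suc j))) = mulx j (Rop (Suc (Suc j)) (dd j (g (Suc j)))) - Rop (Suc j) (g (Suc j))"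
    proof -
      have "mulx (Suc j) (Top (Suc j) (g (Suc j))) = 0"
        by (simp add: Top_eq_Rop_dd diag Rop.zero mulx.zero)
      then have "Rop (Suc j) (g (Suc j)) = Rop (Suc (Suc j)) (g (Suc j))"
        by (simp add: mulx_Top)
      then show ?thesis by (simp add: X_def dd_mulx dd_Rop)
    qed
    finally have ddF: "dd j F = (\<Sum>i=1..<j. X i (dd i (g (Suc j)))) + (Rop j (g j)
      + mulx (Suc j) (Rop j (dd (Suc j) (g j))) + (mulx j (Rop (Suc (Suc j)) (dd j (g (Suc j))))
      - Rop (Suc j) (g (Suc j)))) + (\<Sum>i=Suc (Suc j)..M. X i (dd i (g j)))" .
    have "g j - Rop j (g j) = (\<Sum>i=j..<Suc M. X i (dd i (g j)))"
      using Rop_diff_eq_sum[of j "Suc M" "g j"] Rop_eq_self[OF vg, of "Suc M" j]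
      unfolding X_def M_def by simp
    also have "{j..<Suc M} = {j, Suc j} \<union> {Suc (Suc j)..M}" using M_def by auto
    also have "(\<Sum>i\<in>\<dots>. X i (dd i (g j))) =
        X (Suc j) (dd (Suc j) (g j)) + (\<Sum>i=Suc (Suc j)..M. X i (dd i (g j)))"
      using that by (subst sum.union_disjoint) (auto simp: diag X_def Rop.zero mulx.zero)
    finally have gj: "g j = Rop j (g j) + X (Suc j) (dd (Suc j) (g j)) + (\<Sum>i=Suc (Suc j)..M. X i (dd i (g j)))"
      by (metis add.commute add.assoc diff_add_cancel)
    have "Rop (Suc j) (g (Suc j)) - Rop 1 (g (Suc j)) = (\<Sum>i=1..<j. X i (dd i (g (Suc j)))) + X j (dd j (g (Suc j)))"
      using Rop_diff_eq_sum[of 1 "Suc j" "g (Suc j)"] that unfolding X_def by simp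
    then have gSj: "Rop (Suc j) (g (Suc j)) = Rop 1 (g (Suc j)) + (\<Sum>i=1..<j. X i (dd i (g (Suc j)))) + X j (dd j (g (Suc j)))"
      by (simp add: diff_eq_eq add_ac)
    \<comment> \<open>Moving the inserted 0 costs one correction for \<open>?a\<close> and one for
      \<open>?b\<close>. By the braid hypothesis both equal x_j x_{j+1} times
      \<open>Rop j (dd j ?a)\<close>, so they cancel.\<close>
    let ?a = "dd (Suc j) (g j)" and ?b = "dd j (g (Suc j))"
    have a: "Rop (Suc j) ?a = Rop j ?a + mulx j (Rop j (dd j ?a))"
      using mulx_Top[of j ?a] by (simp add: Top_eq_Rop_dd)
    have b: "Rop (Suc (Suc j)) ?b = Rop j ?b + mulx (Suc j) (Rop j (dd j ?a))"
    proof -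
      have "dd (Suc j) ?b = dd j ?a" using braid that by simp
      then have "Rop (Suc (Suc j)) ?b = Rop (Suc j) ?b + mulx (Suc j) (Rop (Suc j) (dd j ?a))"
        using mulx_Top[of "Suc j" ?b] by (simp add: Top_eq_Rop_dd)
      then show ?thesis by (simp add: Rop_dd_Suc)
    qed
    show ?thesis
      unfolding ddF gSj b
      by (subst gj) (simp add: a X_def mulx.add mulx_commute[of "Suc j" j])
  qed
  \<comment> \<open>The defect \<open>dd j f - g j\<close> is R_1 of the defect at j+1. Beyond N it
    is 0, so it vanishes for every j by descending from there.\<close>
  have step: "dd j f - g j = Rop 1 (dd (Suc j) f - g (Suc j))" if "1 \<le> j" for j
  proof -
    have "dd j f = Rop 1 (dd (Suc j) f) + dd j F"
      using arg_cong[OF f, of "dd j"] that unfolding F_def[symmetric] by (simp add: dd.add dd_Rop)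
    then show ?thesis using key[OF that] by (simp add: Rop.diff)
  qed
  have "dd j f - g j = 0" if "N < j + k" "1 \<le> j" for k j
    using that
  proof (induction k arbitrary: j)
    case 0
    then show ?case using dd_eq_0_of_vars[OF vf, of j] g0[of j] by simp
  next
    case (Suc k)
    then have "dd (Suc j) f - g (Suc j) = 0" by (intro Suc.IH) auto
    then show ?case unfolding step[OF Suc.prems(2)] by (simp only: Rop.zero)
  qed
  from this[of j "Suc N"] \<open>1 \<le> j\<close> show ?thesis by simp
qed

section \<open>Descents and length of permutations\<close>

lemma sref_sref [simp]: "sref i (sref i j) = j"
  by (simp add: sref_def)

lemma bij_sref [simp]: "bij (sref i)"
  by (rule o_bij[of "sref i"]) (auto simp: fun_eq_iff)

lemma permutes_sref:
  assumes "w permutes {1..n}" "1 \<le> i" "i < n"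
  shows "w \<circ> sref i permutes {1..n}"
proof (rule permutes_compose[OF _ assms(1)])
  show "sref i permutes {1..n}"
    using assms bij_sref[of i] unfolding permutes_def bij_iff by (auto simp: sref_def)
qed

lemma descent_less:
  assumes "w permutes {1..n}" "w (Suc i) < w i"
  shows "1 \<le> i \<and> i < n"
proof -
  have "i \<noteq> 0" using assms permutes_not_in[OF assms(1), of 0] by (intro notI) auto
  moreover have "i < n"
  proof (rule ccontr)
    assume "\<not> i < n"
    then have "w (Suc i) = Suc i" using permutes_not_in[OF assms(1), of "Suc i"] by simp
    moreover have "w i \<le> i"
    proof (cases "i = n")
      case True
      then show ?thesis using permutes_in_image[OF assms(1), of i] \<open>i \<noteq> 0\<close> by simp
    next
      case False
      then show ?thesis using permutes_not_in[OF assms(1), of i] \<open>\<not> i < n\<close> by simp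
    qed
    ultimately show False using assms(2) by simp
  qed
  ultimately show ?thesis by simp
qed

lemma finperm_sref: "finperm w \<Longrightarrow> w (Suc i) < w i \<Longrightarrow> finperm (w \<circ> sref i)"
  unfolding finperm_def using permutes_sref descent_less by meson

lemma finite_inversions:
  fixes w :: "nat \<Rightarrow> nat"
  assumes "w permutes {1..n}"
  shows "finite {(i, j). i < j \<and> w j < w i}"
proof (rule finite_subset)
  show "{(i, j). i < j \<and> w j < w i} \<subseteq> {0..n} \<times> {0..n}"
  proof clarify
    fix i j :: nat assume a: "i < j" "w j < w i"
    have "j \<le> n"
    proof (rule ccontr)
      assume j: "\<not> j \<le> n"
      then have "w j = j" using permutes_not_in[OF assms, of j] by simp
      then have "w i > n" "w i \<noteq> i" using a j by simp_all
      then show False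
        using permutes_not_in[OF assms, of i] permutes_in_image[OF assms, of i] by force
    qed
    then show "i \<in> {0..n} \<and> j \<in> {0..n}" using a by simp
  qed
qed simp

lemma sref_less: "a < b \<Longrightarrow> (a, b) \<noteq> (i, Suc i) \<Longrightarrow> sref i a < sref i b"
  by (auto simp: sref_def)

text \<open>Relabelling both positions by s_i preserves the order of every pair other than (i, i+1),
  so it matches the inversions of w s_i with those of w apart from the descent itself.\<close>

lemma plength_descent:
  assumes w: "finperm w" and d: "w (Suc i) < w i"
  shows "plength w = Suc (plength (w \<circ> sref i))"
proof -
  let ?v = "w \<circ> sref i"
  let ?I = "\<lambda>w. {(i, j). i < j \<and> (w j :: nat) < w i}"
  let ?f = "map_prod (sref i) (sref i)"
  have fin: "finite (?I w)"
    using w finite_inversions unfolding finperm_def by blast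
  have 1: "?f p \<in> ?I ?v" if p: "p \<in> ?I w - {(i, Suc i)}" for p
  proof -
    obtain a b where "p = (a, b)" by fastforce
    then show ?thesis using p sref_less[of a b i] by simp
  qed
  have 2: "?f p \<in> ?I w - {(i, Suc i)}" if p: "p \<in> ?I ?v" for p
  proof -
    obtain a b where ab: "p = (a, b)" by fastforce
    have "(a, b) \<noteq> (i, Suc i)" using p d ab by (auto simp: sref_def)
    moreover have "(sref i a, sref i b) \<noteq> (i, Suc i)"
    proof
      assume "(sref i a, sref i b) = (i, Suc i)"
      then have "sref i (sref i a) = sref i i" "sref i (sref i b) = sref i (Suc i)" by simp_all
      then have "a = Suc i" "b = i" unfolding sref_sref by (simp_all add: sref_def)
      then show False using p ab by simp
    qed
    ultimately show ?thesis using p ab sref_less[of a b i] by simp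
  qed
  have "bij_betw ?f (?I w - {(i, Suc i)}) (?I ?v)"
  proof (rule bij_betw_byWitness[where f' = ?f])
    show "?f ` (?I w - {(i, Suc i)}) \<subseteq> ?I ?v" using 1 by (intro image_subsetI)
    show "?f ` ?I ?v \<subseteq> ?I w - {(i, Suc i)}" using 2 by (intro image_subsetI)
  qed (simp_all add: split_paired_all)
  then have "card (?I w - {(i, Suc i)}) = card (?I ?v)" by (rule bij_betw_same_card)
  moreover have "(i, Suc i) \<in> ?I w" using d by simp
  ultimately show ?thesis
    unfolding plength_def by (simp only: card.remove[OF fin])
qed

lemma perm_eq_id:
  assumes "w permutes {1..n}" "\<And>i. \<not> w (Suc i) < w i"
  shows "w = id"
proof -
  have "w i < w (Suc i)" for i
    using assms(2)[of i] permutes_inj[OF assms(1)] by (metis injD n_not_Suc_n nat_neq_iff)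
  then have "strict_mono w" by (simp add: strict_mono_Suc_iff)
  then have "id i = w i" for i
  proof (induction i rule: less_induct)
    case (less i)
    obtain j where j: "w j = i" using permutes_surj[OF assms(1)] by (metis surjD)
    have "\<not> j < i" using less.IH[OF _ less.prems, of j] j by auto
    moreover have "\<not> i < j" using strict_mono_imp_increasing[OF less.prems, of i] j strict_monoD[OF less.prems, of i j] by auto
    ultimately show ?case using j by (metis id_apply linorder_neqE_nat)
  qed
  then show ?thesis by auto
qed

section \<open>Recursive construction of a Schubert family\<close>

definition perm_bound :: "(nat \<Rightarrow> nat) \<Rightarrow> nat" where
  "perm_bound w = (LEAST n. w permutes {1..n})"

lemma perm_bound:
  assumes "w permutes {1..n}"
  shows "w permutes {1..perm_bound w}" "perm_bound w \<le> n"
  unfolding perm_bound_def using assms by (auto intro: LeastI Least_le)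

text \<open>The solution of \<open>S = Rop 1 S + F\<close> with \<open>F = (\<Sum>i. x\<^sub>i R\<^sub>i \<SS>\<^bsub>w s\<^sub>i\<^esub>)\<close>, where \<open>i\<close> ranges over the
  descents of \<open>w\<close>: this is the telescoping sum of \<open>x\<^sub>i R\<^sub>i \<partial>\<^sub>i \<SS>\<^sub>w\<close>.\<close>

function schub :: "(nat \<Rightarrow> nat) \<Rightarrow> ipoly" where
  "schub w = (if \<not> finperm w \<or> w = id then pone else
     (\<Sum>k<perm_bound w. (Rop 1 ^^ k) (\<Sum>i\<in>{i. w (Suc i) < w i}. mulx i (Rop i (schub (w \<circ> sref i))))))"
  by auto
termination
  by (relation "measure plength") (auto simp: plength_descent)

declare schub.simps [simp del]

definition schub_or_0 :: "(nat \<Rightarrow> nat) \<Rightarrow> nat \<Rightarrow> ipoly" where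
  "schub_or_0 w i = (if w (Suc i) < w i then schub (w \<circ> sref i) else 0)"

lemma vars_0_homog_Suc:
  assumes "vars 0 f" "homog (Suc d) f"
  shows "f = 0"
proof
  fix m
  show "f m = 0 m"
  proof (rule ccontr)
    assume "f m \<noteq> 0 m"
    then have "f m \<noteq> 0" by simp
    then have "m = (\<lambda>_. 0)" "mdeg m = Suc d"
      using assms unfolding vars_def homog_def by fastforce+
    then show False by (simp add: mdeg_def)
  qed
qed

lemma homog_Rop_pow: "homog d f \<Longrightarrow> homog d ((Rop 1 ^^ k) f)"
  by (induction k) (auto intro: homog_Rop)

lemma vars_Rop_pow: "vars n f \<Longrightarrow> vars n ((Rop 1 ^^ k) f)"
  by (induction k) (auto intro: vars_Rop)

lemma vars_Rop_pow_diff: "vars n f \<Longrightarrow> k \<le> n \<Longrightarrow> vars (n - k) ((Rop 1 ^^ k) f)"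
proof (induction k)
  case (Suc k)
  then have "vars (Suc (n - Suc k)) ((Rop 1 ^^ k) f)" by (simp add: Suc_diff_Suc)
  then show ?case using vars_Rop1 by simp
qed simp

lemma swapm_eq_0_iff: "swapm i m = (\<lambda>_. 0) \<longleftrightarrow> m = (\<lambda>_. 0)"
proof
  assume a: "swapm i m = (\<lambda>_. 0)"
  have "m = swapm i (swapm i m)" by (auto simp: swapm_def)
  then show "m = (\<lambda>_. 0)" unfolding a by (simp add: swapm_def fun_eq_iff)
qed (simp add: swapm_def fun_eq_iff)

lemma psw_pone [simp]: "psw i pone = pone"
  by (simp add: fun_eq_iff[where f = "psw i pone"] psw_def pone_def swapm_eq_0_iff)

text \<open>Strong induction on the length: the Coxeter relations turn the hypotheses for shorter
  permutations into the compatibility conditions of \<open>dd_integrable\<close>. Variables and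
  degree are carried along because they make the iterates of R_1 die out.\<close>

lemma schub_props:
  assumes "finperm w"
  shows "vars (perm_bound w) (schub w) \<and> homog (plength w) (schub w)
    \<and> (\<forall>i\<ge>1. dd i (schub w) = schub_or_0 w i)"
  using assms
proof (induction "plength w" arbitrary: w rule: less_induct)
  case less
  show ?case
  proof (cases "w = id")
    case True
    have "plength id = 0" unfolding plength_def by (auto simp: card_eq_0_iff)
    have "vars n pone" "homog 0 pone" for n
      by (auto simp: vars_def homog_def pone_def mdeg_def)
    then show ?thesis
      using True \<open>plength id = 0\<close> by (simp add: schub.simps[of id] schub_or_0_def dd_eq_0_iff psw_pone)
  next
    case False
    define N g F where "N = perm_bound w" and "g = schub_or_0 w"
      and "F = (\<Sum>i\<in>{i. w (Suc i) < w i}. mulx i (Rop i (schub (w \<circ> sref i))))"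
    have wN: "w permutes {1..N}"
      using less.prems perm_bound unfolding finperm_def N_def by blast
    have schub_w: "schub w = (\<Sum>k<N. (Rop 1 ^^ k) F)"
      using less.prems False by (subst schub.simps) (simp add: N_def F_def)
    have IH: "vars N (schub (w \<circ> sref i)) \<and> homog (plength w - 1) (schub (w \<circ> sref i))
      \<and> (\<forall>j\<ge>1. dd j (schub (w \<circ> sref i)) = schub_or_0 (w \<circ> sref i) j)"
      if d: "w (Suc i) < w i" for i
    proof -
      have "perm_bound (w \<circ> sref i) \<le> N"
        using perm_bound(2) permutes_sref[OF wN] descent_less[OF wN d] by blast
      then show ?thesis
        using less.hyps[of "w \<circ> sref i"] finperm_sref[OF less.prems d] plength_descent[OF less.prems d]
        by (simp add: vars_mono[of "perm_bound (w \<circ> sref i)"])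
    qed
    have dsub: "{i. w (Suc i) < w i} \<subseteq> {1..N}"
      by (auto dest: descent_less[OF wN])
    have "\<exists>i. w (Suc i) < w i" using perm_eq_id[OF wN] False by blast
    then obtain l where l: "plength w = Suc l" using plength_descent[OF less.prems] by blast
    have vF: "vars N F"
      unfolding F_def using dsub IH by (intro vars_sum vars_mulx vars_Rop) auto
    have hF: "homog (plength w) F"
      unfolding F_def using IH l by (auto intro!: homog_sum homog_mulx homog_Rop)
    have Fg: "F = (\<Sum>i=1..N. mulx i (Rop i (g i)))"
      unfolding F_def using dsub
      by (intro sum.mono_neutral_cong_left) (auto simp: g_def schub_or_0_def Rop.zero mulx.zero)
    have v: "vars N (schub w)" unfolding schub_w by (intro vars_sum vars_Rop_pow vF)
    have h: "homog (plength w) (schub w)" unfolding schub_w by (intro homog_sum homog_Rop_pow hF)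
    \<comment> \<open>Each R_1 removes one variable, so N of them leave a constant; F is homogeneous
      of positive degree, so this constant is 0. Hence the finite sum solves S = R_1 S + F.\<close>
    have "(Rop 1 ^^ N) F = 0"
      using vars_Rop_pow_diff[OF vF, of N] homog_Rop_pow[OF hF] l
      by (intro vars_0_homog_Suc[where d = l]) simp_all
    then have rec: "schub w = Rop 1 (schub w) + F"
    proof -
      assume 0: "(Rop 1 ^^ N) F = 0"
      have "Rop 1 (schub w) + F = (\<Sum>k<N. (Rop 1 ^^ Suc k) F) + F"
        unfolding schub_w by (simp add: Rop.sum)
      also have "\<dots> = (\<Sum>k<Suc N. (Rop 1 ^^ k) F)"
        by (subst sum.lessThan_Suc_shift) (simp add: add.commute)
      also have "\<dots> = schub w" using 0 schub_w by simp
      finally show ?thesis by simp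
    qed
    have ddg: "dd j (g i) = (if w (Suc i) < w i \<and> (w \<circ> sref i) (Suc j) < (w \<circ> sref i) j
      then schub (w \<circ> sref i \<circ> sref j) else 0)" if "1 \<le> j" for i j
      using IH[of i] that by (auto simp: g_def schub_or_0_def dd.zero)
    have "dd j (schub w) = g j" if "1 \<le> j" for j
    proof (rule dd_integrable[where N = N and g = g])
      show "vars N (g i)" for i using IH[of i] by (auto simp: g_def schub_or_0_def)
      show "g i = 0" if "N < i" for i
        using dsub that by (auto simp: g_def schub_or_0_def)
      show "dd i (g i) = 0" if "1 \<le> i" for i
        using ddg[OF that, of i] by (simp add: sref_def) (meson less_asym)
      show "dd i (g j) = dd j (g i)" if ij: "1 \<le> i" "Suc i < j" for i j
      proof -
        have "w \<circ> sref i \<circ> sref j = w \<circ> sref j \<circ> sref i"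
          using ij by (auto simp: fun_eq_iff sref_def)
        moreover have "(w \<circ> sref i) (Suc j) = w (Suc j)" "(w \<circ> sref i) j = w j"
          "(w \<circ> sref j) (Suc i) = w (Suc i)" "(w \<circ> sref j) i = w i"
          using ij by (simp_all add: sref_def)
        ultimately show ?thesis using ddg[where i = i and j = j] ddg[where i = j and j = i] ij
          by (simp only: conj_commute)
      qed
      show "dd i (dd (Suc i) (g i)) = dd (Suc i) (dd i (g (Suc i)))" if i: "1 \<le> i" for i
      proof -
        \<comment> \<open>\<open>?P\<close> says that w decreases along i, i+1, i+2. Either order of
          three descents is possible exactly then, and both end at the same permutation by the braid
          relation.\<close>
        let ?P = "w (Suc (Suc i)) < w (Suc i) \<and> w (Suc i) < w i"
        have dd2: "dd k (dd j (g i)) = (if w (Suc i) < w i \<and> (w \<circ> sref i) (Suc j) < (w \<circ> sref i) j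
            \<and> (w \<circ> sref i \<circ> sref j) (Suc k) < (w \<circ> sref i \<circ> sref j) k
          then schub (w \<circ> sref i \<circ> sref j \<circ> sref k) else 0)" if "1 \<le> j" "1 \<le> k" for i j k
        proof (cases "w (Suc i) < w i \<and> (w \<circ> sref i) (Suc j) < (w \<circ> sref i) j")
          case True
          let ?u = "w \<circ> sref i" let ?v = "?u \<circ> sref j"
          have u: "finperm ?u" "plength w = Suc (plength ?u)"
            using True finperm_sref plength_descent less.prems by blast+
          have "finperm ?v" "plength ?u = Suc (plength ?v)"
            using True finperm_sref[OF u(1)] plength_descent[OF u(1)] by blast+
          then have "dd k (schub ?v) = schub_or_0 ?v k"
            using less.hyps[of ?v] u \<open>1 \<le> k\<close> by auto
          then show ?thesis
            using True ddg[OF \<open>1 \<le> j\<close>, of i] by (simp add: schub_or_0_def)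
        next
          case False
          then show ?thesis using ddg[OF \<open>1 \<le> j\<close>, of i]
            by (cases "w (Suc i) < w i"; simp add: dd.zero del: o_apply)
        qed
        have weq: "w \<circ> sref i \<circ> sref (Suc i) \<circ> sref i = w \<circ> sref (Suc i) \<circ> sref i \<circ> sref (Suc i)"
          by (auto simp: fun_eq_iff sref_def)
        have eqs: "(w \<circ> sref i) (Suc (Suc i)) = w (Suc (Suc i))" "(w \<circ> sref i) (Suc i) = w i"
          "(w \<circ> sref i \<circ> sref (Suc i)) (Suc i) = w (Suc (Suc i))" "(w \<circ> sref i \<circ> sref (Suc i)) i = w (Suc i)"
          "(w \<circ> sref (Suc i)) (Suc i) = w (Suc (Suc i))" "(w \<circ> sref (Suc i)) i = w i"
          "(w \<circ> sref (Suc i) \<circ> sref i) (Suc (Suc i)) = w (Suc i)" "(w \<circ> sref (Suc i) \<circ> sref i) (Suc i) = w i"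
          by (simp_all add: sref_def)
        have P: "w (Suc i) < w i \<and> w (Suc (Suc i)) < w i \<and> w (Suc (Suc i)) < w (Suc i) \<longleftrightarrow> ?P"
          "w (Suc (Suc i)) < w (Suc i) \<and> w (Suc (Suc i)) < w i \<and> w (Suc i) < w i \<longleftrightarrow> ?P"
          by auto
        have i': "1 \<le> Suc i" by simp
        have d1: "dd i (dd (Suc i) (g i)) = (if ?P then schub (w \<circ> sref i \<circ> sref (Suc i) \<circ> sref i) else 0)"
          by (simp only: dd2[OF i' i, of i, unfolded eqs] P)
        have d2: "dd (Suc i) (dd i (g (Suc i))) = (if ?P then schub (w \<circ> sref (Suc i) \<circ> sref i \<circ> sref (Suc i)) else 0)"
          by (simp only: dd2[OF i i', of "Suc i", unfolded eqs] P)
        show ?thesis unfolding d1 d2 weq ..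
      qed
      show "vars N (schub w)" by (rule v)
      show "schub w = Rop 1 (schub w) + (\<Sum>i=1..N. mulx i (Rop i (g i)))"
        by (rule rec[unfolded Fg])
      show "1 \<le> j" by (rule that)
    qed
    then show ?thesis using v h by (simp add: N_def g_def)
  qed
qed

text \<open>This witness ensures that \<open>schubert\<close>, which is defined by choice, satisfies
  its axioms; positivity is then derived from the axioms alone.\<close>

lemma schubert_family_schub: "schubert_family schub"
  unfolding schubert_family_def
proof (intro conjI allI impI; (elim conjE)?)
  show "schub id = pone" by (simp add: schub.simps)
next
  fix w :: "nat \<Rightarrow> nat" and i :: nat assume "finperm w" "1 \<le> i"
  then have "dd i (schub w) = schub_or_0 w i" using schub_props by blast
  then show "schub w - psw i (schub w) = pmuld i (if w (Suc i) < w i then schub (w \<circ> sref i) else (\<lambda>_. 0))"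
    using pmuld_dd[of i "schub w"] by (simp only: schub_or_0_def flip: zero_fun_def)
next
  fix w :: "nat \<Rightarrow> nat" and m assume "finperm w" "schub w m \<noteq> 0"
  then show "finite {j. m j \<noteq> 0}" "mdeg m = plength w"
    using schub_props unfolding homog_def by blast+
next
  fix w :: "nat \<Rightarrow> nat" and n j :: nat and m assume w: "w permutes {1..n}" and nz: "schub w m \<noteq> 0" "m j \<noteq> 0"
  then have "vars n (schub w)"
    using schub_props perm_bound[OF w] vars_mono unfolding finperm_def by blast
  then show "j \<in> {1..n}" using nz unfolding vars_def by blast
qed

lemma schubert:
  assumes w: "w permutes {1..n}"
  shows "schubert id = pone"
    and "vars n (schubert w)" and "homog (plength w) (schubert w)"
    and "1 \<le> i \<Longrightarrow> dd i (schubert w) = (if w (Suc i) < w i then schubert (w \<circ> sref i) else 0)"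
proof -
  have fam: "schubert_family schubert"
    unfolding schubert_def using schubert_family_schub by (rule someI[of schubert_family])
  have fin: "finperm w" using w unfolding finperm_def by blast
  note D = fam[unfolded schubert_family_def]
  note D1 = D[THEN conjunct2, THEN conjunct1, rule_format, OF conjI, OF fin]
    and D2 = D[THEN conjunct2, THEN conjunct2, THEN conjunct1, rule_format, OF conjI, OF fin]
    and D3 = D[THEN conjunct2, THEN conjunct2, THEN conjunct2, rule_format, OF conjI, OF w]
  show "schubert id = pone" by (rule D[THEN conjunct1])
  show "vars n (schubert w)" unfolding vars_def by (intro allI impI) (rule D3)
  show "homog (plength w) (schubert w)" unfolding homog_def by (intro allI impI) (rule D2)
  show "1 \<le> i \<Longrightarrow> dd i (schubert w) = (if w (Suc i) < w i then schubert (w \<circ> sref i) else 0)"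
    by (rule dd_unique) (simp only: D1 zero_fun_def)
qed

section \<open>The sum of all sequences of trimming operators\<close>

declare plus_fun_apply [simp del] minus_apply [simp del] zero_fun_apply [simp del] uminus_apply [simp del]

text \<open>This is the functional L. The recursion peels off the operator that is applied first,
  hence stands last in the sequence and has the widest index range.\<close>

primrec Tsum :: "nat \<Rightarrow> ipoly \<Rightarrow> int" where
  "Tsum 0 f = f (\<lambda>_. 0)"
| "Tsum (Suc k) f = (\<Sum>j=1..Suc k. Tsum k (Top j f))"

interpretation Tsum: additive "Tsum k" for k
proof
  show "Tsum k (f + g) = Tsum k f + Tsum k g" for f g
    by (induction k arbitrary: f g) (simp_all add: Top.add sum.distrib plus_fun_apply)
qed

text \<open>The product with u_i is kept as an operator, since \<open>*\<close> on coefficient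
  functions is pointwise.\<close>

definition U :: "nat \<Rightarrow> ipoly \<Rightarrow> ipoly" where
  "U i f = (\<Sum>j=1..i. mulx j f)"

interpretation U: additive "U i" for i
  by standard (simp add: U_def mulx.add sum.distrib)

lemma U_0 [simp]: "U 0 f = 0"
  by (simp add: U_def)

lemma U_Suc: "U (Suc i) f = U i f + mulx (Suc i) f"
  by (simp add: U_def)

lemma mulx_U: "mulx j (U i f) = U i (mulx j f)"
  unfolding U_def mulx.sum by (simp only: mulx_commute[of j])

lemma U_commute: "U i (U j f) = U j (U i f)"
  unfolding U_def[of i] U.sum mulx_U ..

lemma Rop_U_less: "i < j \<Longrightarrow> Rop j (U i f) = U i (Rop j f)"
  unfolding U_def Rop.sum by (intro sum.cong) (auto simp: Rop_mulx_less)

lemma Rop_U_ge: "1 \<le> j \<Longrightarrow> j \<le> Suc i \<Longrightarrow> Rop j (U (Suc i) f) = U i (Rop j f)"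
proof (induction i)
  case 0
  then have "j = 1" by simp
  then show ?case by (simp add: U_Suc Rop.add Rop.zero)
next
  case (Suc i)
  show ?case
  proof (cases "j = Suc (Suc i)")
    case True
    then show ?thesis by (simp add: U_Suc[of "Suc i"] Rop.add Rop_U_less)
  next
    case False
    then have "Rop j (U (Suc i) f) = U i (Rop j f)" "j \<le> Suc i" using Suc by simp_all
    then show ?thesis by (simp add: U_Suc[of "Suc i"] U_Suc[of i] Rop.add Rop_mulx_ge)
  qed
qed

text \<open>Inserting 0 at j shortens u_i by one variable if j \<le> i and leaves it alone
  otherwise. Only for i = j do the two insertions inside T_j act differently on u_i, which produces
  the extra term.\<close>

lemma Top_U:
  "i < j \<Longrightarrow> Top j (U i f) = U i (Top j f)"
  "1 \<le> j \<Longrightarrow> j \<le> i \<Longrightarrow> Top j (U (Suc i) f) = U i (Top j f)"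
  "Top (Suc j) (U (Suc j) f) = U (Suc j) (Top (Suc j) f) + Rop (Suc j) f"
proof -
  show "i < j \<Longrightarrow> Top j (U i f) = U i (Top j f)"
    by (rule mulx_cancel[of j]) (simp add: mulx_Top mulx_U Rop_U_less U.diff)
  show "1 \<le> j \<Longrightarrow> j \<le> i \<Longrightarrow> Top j (U (Suc i) f) = U i (Top j f)"
    by (rule mulx_cancel[of j]) (simp add: mulx_Top mulx_U Rop_U_ge U.diff)
  have "Rop (Suc (Suc j)) (U (Suc j) f) = U (Suc j) (Rop (Suc (Suc j)) f)"
    by (rule Rop_U_less) simp
  moreover have "Rop (Suc j) (U (Suc j) f) = U j (Rop (Suc j) f)"
    by (rule Rop_U_ge) simp_all
  ultimately show "Top (Suc j) (U (Suc j) f) = U (Suc j) (Top (Suc j) f) + Rop (Suc j) f"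
    by - (rule mulx_cancel[of "Suc j"],
      simp add: mulx_Top mulx.add mulx_U U.diff U_Suc[of j "Rop (Suc j) f"])
qed

lemma Rop_pmuld:
  "Suc i < j \<Longrightarrow> Rop j (pmuld i f) = pmuld i (Rop j f)"
  "Rop (Suc i) (pmuld i f) = mulx i (Rop (Suc i) f)"
  "Rop i (pmuld i f) = - mulx i (Rop i f)"
  "j \<le> i \<Longrightarrow> Rop j (pmuld (Suc i) f) = pmuld i (Rop j f)"
  by (simp_all add: pmuld_mulx Rop.diff Rop_mulx_less Rop_mulx_ge)

lemma mulx_pmuld: "mulx j (pmuld i f) = pmuld i (mulx j f)"
  by (simp add: pmuld_mulx mulx.diff mulx_commute)

lemma U_pmuld_diff: "U i (pmuld i f) = U i (mulx i f) - U i (mulx (Suc i) f)"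
  by (simp add: pmuld_mulx U.diff)

text \<open>T_j carries a multiple of u_i (x_i - x_{i+1}) to a multiple of the same kind, apart from
  corrections at j = i-1, i, i+1; at j = i only corrections remain. They cancel in the sum over
  j.\<close>

lemma Top_U_pmuld:
  "Suc i < j \<Longrightarrow> Top j (U i (pmuld i f)) = U i (pmuld i (Top j f))"
  "Top (Suc i) (U i (pmuld i f)) = U i (pmuld i (Top (Suc i) f)) - U i (Rop (Suc i) f)"
  "Top (Suc i) (U (Suc i) (pmuld (Suc i) f)) = U (Suc i) (Rop (Suc (Suc i)) f) + U i (Rop (Suc i) f)"
  "1 \<le> i \<Longrightarrow> Top i (U (Suc i) (pmuld (Suc i) f)) = U i (pmuld i (Top i f)) - U i (Rop (Suc i) f)"
  "1 \<le> j \<Longrightarrow> j < i \<Longrightarrow> Top j (U (Suc i) (pmuld (Suc i) f)) = U i (pmuld i (Top j f))"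
proof -
  show "Suc i < j \<Longrightarrow> Top j (U i (pmuld i f)) = U i (pmuld i (Top j f))"
    by (rule mulx_cancel[of j]) (simp add: mulx_Top mulx_U mulx_pmuld Rop_U_less Rop_pmuld U.diff pmuld.diff)
  have R: "Rop (Suc i) f = Rop i f + mulx i (Top i f)" for i by (simp add: mulx_Top)
  show "Top (Suc i) (U i (pmuld i f)) = U i (pmuld i (Top (Suc i) f)) - U i (Rop (Suc i) f)"
  proof (rule mulx_cancel[of "Suc i"])
    have "mulx (Suc i) (Top (Suc i) (U i (pmuld i f)))
        = U i (pmuld i (Rop (Suc (Suc i)) f)) - U i (mulx i (Rop (Suc i) f))"
      by (simp add: mulx_Top Rop_U_less Rop_pmuld)
    also have "\<dots> = U i (pmuld i (mulx (Suc i) (Top (Suc i) f))) - U i (mulx (Suc i) (Rop (Suc i) f))"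
      by (simp only: R[of "Suc i"] pmuld.add U.add U_pmuld_diff[of i "Rop (Suc i) f"]) simp
    finally show "mulx (Suc i) (Top (Suc i) (U i (pmuld i f)))
        = mulx (Suc i) (U i (pmuld i (Top (Suc i) f)) - U i (Rop (Suc i) f))"
      by (simp add: mulx.diff mulx_U mulx_pmuld)
  qed
  show "Top (Suc i) (U (Suc i) (pmuld (Suc i) f)) = U (Suc i) (Rop (Suc (Suc i)) f) + U i (Rop (Suc i) f)"
    by (rule mulx_cancel[of "Suc i"])
      (simp add: mulx_Top Rop_U_less Rop_U_ge Rop_pmuld mulx.add mulx_U U.minus)
  show "Top i (U (Suc i) (pmuld (Suc i) f)) = U i (pmuld i (Top i f)) - U i (Rop (Suc i) f)" if "1 \<le> i"
  proof (rule mulx_cancel[of i])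
    have "mulx i (Top i (U (Suc i) (pmuld (Suc i) f)))
        = - U i (mulx (Suc i) (Rop (Suc i) f)) - U i (pmuld i (Rop i f))"
      using that by (simp add: mulx_Top Rop_U_ge Rop_pmuld U.minus)
    also have "U i (pmuld i (Rop i f)) = U i (pmuld i (Rop (Suc i) f)) - U i (pmuld i (mulx i (Top i f)))"
      by (simp only: R[of i] pmuld.add U.add) simp
    also have "- U i (mulx (Suc i) (Rop (Suc i) f)) - \<dots> = U i (pmuld i (mulx i (Top i f))) - U i (mulx i (Rop (Suc i) f))"
      by (simp only: U_pmuld_diff[of i "Rop (Suc i) f"]) simp
    finally show "mulx i (Top i (U (Suc i) (pmuld (Suc i) f)))
        = mulx i (U i (pmuld i (Top i f)) - U i (Rop (Suc i) f))"
      by (simp add: mulx.diff mulx_U mulx_pmuld)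
  qed
  show "1 \<le> j \<Longrightarrow> j < i \<Longrightarrow> Top j (U (Suc i) (pmuld (Suc i) f)) = U i (pmuld i (Top j f))"
    by (rule mulx_cancel[of j]) (simp add: mulx_Top mulx_U mulx_pmuld Rop_U_ge Rop_pmuld U.diff pmuld.diff)
qed

text \<open>With \<open>u\<^sub>i = x\<^sub>1 + \<dots> + x\<^sub>i\<close>, the next two lemmas are the relations \<open>u\<^sub>n = 0\<close> and
  \<open>u\<^sub>i (x\<^sub>i - x\<^sub>i\<^sub>+\<^sub>1) = 0\<close> of the Klyachko algebra, for \<open>n = Suc k\<close>.\<close>

lemma Tsum_U_Suc: "Tsum k (U (Suc k) f) = 0"
proof (induction k arbitrary: f)
  case (Suc k)
  then show ?case by (simp del: sum.cl_ivl_Suc add: Top_U)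
qed (simp add: U_Suc mulx_def plus_fun_apply zero_fun_apply)

lemma Tsum_U_pmuld: "1 \<le> i \<Longrightarrow> i \<le> k \<Longrightarrow> Tsum k (U i (pmuld i f)) = 0"
proof (induction k arbitrary: i f)
  case (Suc k)
  then obtain l where i: "i = Suc l" by (cases i) auto
  define a b where "a = Tsum k (U i (Rop (Suc i) f))" and "b = Tsum k (U l (Rop i f))"
  have "Tsum k (Top j (U i (pmuld i f))) =
      (if j = i then a + b else 0) - (if j = Suc i then a else 0) - (if j = l then b else 0)"
    if "j \<in> {1..Suc k}" for j
  proof -
    consider "j < l" | "j = l" | "j = i" | "j = Suc i" | "Suc i < j" using i by linarith
    then show ?thesis
    proof cases
      case 1
      then show ?thesis using that i Suc.IH[of l] Suc.prems by (simp add: Top_U_pmuld)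
    next
      case 2
      then show ?thesis using that i Suc.IH[of l] Suc.prems
        by (simp add: Top_U_pmuld Tsum.diff a_def b_def)
    next
      case 3
      then show ?thesis using i by (simp add: Top_U_pmuld Tsum.add a_def b_def)
    next
      case 4
      then show ?thesis using that i Suc.IH[of i] Suc.prems
        by (simp add: Top_U_pmuld(2) Tsum.diff a_def b_def)
    next
      case 5
      then show ?thesis using that i Suc.IH[of i] Suc.prems by (simp add: Top_U_pmuld(1))
    qed
  qed
  then have "Tsum (Suc k) (U i (pmuld i f)) = (\<Sum>j=1..Suc k.
      (if j = i then a + b else 0) - (if j = Suc i then a else 0) - (if j = l then b else 0))"
    by (simp del: sum.cl_ivl_Suc)
  also have "\<dots> = (a + b) - (if i \<le> k then a else 0) - (if 1 \<le> l then b else 0)"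
    using Suc.prems i by (simp add: sum_subtractf sum.delta del: sum.cl_ivl_Suc)
  \<comment> \<open>At the ends a neighbour is missing from the sum. For i = k+1 there is no
    T_{i+1}, but then a = 0 because L kills multiples of u_{k+1}; for i = 1 there is no T_0, but
    then b = 0 because u_0 = 0.\<close>
  also have "\<dots> = 0"
  proof -
    have "\<not> i \<le> k \<Longrightarrow> a = 0" using Suc.prems Tsum_U_Suc[of k] by (simp add: a_def le_Suc_eq)
    moreover have "\<not> 1 \<le> l \<Longrightarrow> b = 0" by (simp add: b_def Tsum.zero not_le)
    ultimately show ?thesis by auto
  qed
  finally show ?case .
qed simp

interpretation U: comp_fun_commute U
  by standard (simp add: fun_eq_iff U_commute)

lemma Top_pone [simp]: "Top j pone = 0"
  by (simp add: Top_eq_Rop_dd dd_eq_0_iff[THEN iffD2] Rop.zero)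

lemma Rop_pone [simp]: "1 \<le> j \<Longrightarrow> Rop j pone = pone"
  by (rule Rop_eq_self[of 0]) (auto simp: vars_def pone_def)

lemma fold_U_Suc: "Finite_Set.fold U f {1..Suc k} = U (Suc k) (Finite_Set.fold U f {1..k})"
  by (simp add: atLeastAtMostSuc_conv)

text \<open>For j \<le> k, T_j lowers the top factor u_{k+1} to u_k and induction handles the rest;
  for j = k+1 it kills u_1 ... u_k, so only the extra term of \<open>Top_U\<close> remains. All k+1
  summands of L agree, which yields the factorial.\<close>

lemma Top_prod_U:
  "k < j \<Longrightarrow> Top j (Finite_Set.fold U pone {1..k}) = 0"
  "k < j \<Longrightarrow> Rop j (Finite_Set.fold U pone {1..k}) = Finite_Set.fold U pone {1..k}"
  "1 \<le> j \<Longrightarrow> j \<le> Suc k \<Longrightarrow> Top j (Finite_Set.fold U pone {1..Suc k}) = Finite_Set.fold U pone {1..k}"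
proof -
  show 1: "k < j \<Longrightarrow> Top j (Finite_Set.fold U pone {1..k}) = 0" for k j
  proof (induction k)
    case (Suc k)
    then show ?case unfolding fold_U_Suc by (simp add: Top_U U.zero)
  qed simp
  show 2: "k < j \<Longrightarrow> Rop j (Finite_Set.fold U pone {1..k}) = Finite_Set.fold U pone {1..k}" for k j
  proof (induction k)
    case (Suc k)
    then show ?case unfolding fold_U_Suc by (simp add: Rop_U_less)
  qed simp
  show "1 \<le> j \<Longrightarrow> j \<le> Suc k \<Longrightarrow> Top j (Finite_Set.fold U pone {1..Suc k}) = Finite_Set.fold U pone {1..k}"
  proof (induction k)
    case 0
    then have "j = Suc 0" by simp
    then show ?case unfolding fold_U_Suc by (simp add: Top_U U.zero)
  next
    case (Suc k)
    show ?case
    proof (cases "j = Suc (Suc k)")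
      case True
      then show ?thesis unfolding fold_U_Suc[of _ "Suc k"] by (simp only: Top_U 1[OF lessI] 2[OF lessI] U.zero) simp
    next
      case False
      then show ?thesis using Suc unfolding fold_U_Suc[of _ "Suc k"]
        by (simp only: Top_U) (simp add: fold_U_Suc flip: One_nat_def)
    qed
  qed
qed

lemma Tsum_prod_U: "Tsum k (Finite_Set.fold U pone {1..k}) = fact k"
proof (induction k)
  case (Suc k)
  have "Tsum (Suc k) (Finite_Set.fold U pone {1..Suc k}) = (\<Sum>j=1..Suc k. fact k)"
    unfolding Tsum.simps by (intro sum.cong refl) (simp only: Top_prod_U atLeastAtMost_iff Suc)
  then show ?case by simp
qed (simp add: pone_def)

section \<open>Positivity\<close>

text \<open>Quantifying over all monomial multiples makes this an ideal inside the kernel of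
  \<open>Tsum k\<close>, so relations may be multiplied by variables before L is applied.\<close>

definition null :: "nat \<Rightarrow> ipoly \<Rightarrow> bool" where
  "null k f \<longleftrightarrow> (\<forall>bs. Tsum k (foldr mulx bs f) = 0)"

interpretation foldr_mulx: additive "foldr mulx bs" for bs
proof
  show "foldr mulx bs (f + g) = foldr mulx bs f + foldr mulx bs g" for f g
    by (induction bs) (simp_all add: mulx.add)
qed

interpretation foldr_U: additive "foldr U bs" for bs
proof
  show "foldr U bs (f + g) = foldr U bs f + foldr U bs g" for f g
    by (induction bs) (simp_all add: U.add)
qed

lemma null_0: "null k 0"
  by (simp add: null_def foldr_mulx.zero Tsum.zero)

lemma null_add: "null k f \<Longrightarrow> null k g \<Longrightarrow> null k (f + g)"
  by (simp add: null_def foldr_mulx.add Tsum.add)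

lemma null_diff: "null k f \<Longrightarrow> null k g \<Longrightarrow> null k (f - g)"
  by (simp add: null_def foldr_mulx.diff Tsum.diff)

lemma null_sum: "(\<And>i. i \<in> A \<Longrightarrow> null k (f i)) \<Longrightarrow> null k (\<Sum>i\<in>A. f i)"
  by (induction A rule: infinite_finite_induct) (auto intro: null_add null_0)

lemma null_mulx: "null k f \<Longrightarrow> null k (mulx b f)"
  unfolding null_def
proof
  fix bs assume "\<forall>bs. Tsum k (foldr mulx bs f) = 0"
  from spec[OF this, of "bs @ [b]"] show "Tsum k (foldr mulx bs (mulx b f)) = 0" by simp
qed

lemma null_U: "null k f \<Longrightarrow> null k (U i f)"
  unfolding U_def by (intro null_sum null_mulx)

lemma null_foldr_U: "null k f \<Longrightarrow> null k (foldr U bs f)"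
  by (induction bs) (auto intro: null_U)

lemma Tsum_null: "null k f \<Longrightarrow> Tsum k f = 0"
  unfolding null_def by (drule spec[of _ "[]"]) simp

lemma foldr_mulx_U: "foldr mulx bs (U i f) = U i (foldr mulx bs f)"
  by (induction bs) (simp_all add: mulx_U)

lemma foldr_mulx_pmuld: "foldr mulx bs (pmuld i f) = pmuld i (foldr mulx bs f)"
  by (induction bs) (simp_all add: mulx_pmuld)

lemma null_U_Suc: "null k (U (Suc k) f)"
  by (simp add: null_def foldr_mulx_U Tsum_U_Suc)

text \<open>The extreme indices are harmless: u_0 = 0, and every multiple of u_{k+1} is null. All
  indices from 0 to k+1 occur through \<open>Euler_mulx\<close>.\<close>

lemma null_U_pmuld: "i \<le> Suc k \<Longrightarrow> null k (U i (pmuld i f))"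
proof -
  assume "i \<le> Suc k"
  then consider "i = 0" | "1 \<le> i" "i \<le> k" | "i = Suc k" by linarith
  then show ?thesis
    by cases (simp_all add: null_0 null_U_Suc, simp add: null_def foldr_mulx_U foldr_mulx_pmuld Tsum_U_pmuld)
qed

section \<open>Klyachko's operator and the degree\<close>

definition Euler :: "nat \<Rightarrow> ipoly \<Rightarrow> ipoly" where
  "Euler n f = (\<Sum>i=1..n. U i (dd i f))"

interpretation Euler: additive "Euler n" for n
  by standard (simp add: Euler_def dd.add U.add sum.distrib)

text \<open>Only the divided differences at j and j-1 fail to commute with x_j. They leave u_j f -
  u_{j-1} f = x_j f, up to multiples of u_i (x_i - x_{i+1}).\<close>

lemma Euler_mulx:
  assumes "1 \<le> j" "j \<le> n"
  shows "Euler n (mulx j f) = mulx j (Euler n f) + mulx j f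
    - U j (pmuld j (dd j f)) + U (j - 1) (pmuld (j - 1) (dd (j - 1) f))"
proof -
  obtain l where j: "j = Suc l" using assms by (cases j) auto
  let ?a = "U j f - U j (pmuld j (dd j f))" and ?b = "U l (pmuld l (dd l f)) - U l f"
  have "U i (dd i (mulx j f)) = mulx j (U i (dd i f)) + (if i = j then ?a else 0) + (if i = l then ?b else 0)" for i
  proof -
    consider "i = j" | "i = l" | "i \<noteq> j" "i \<noteq> l" by blast
    then show ?thesis
    proof cases
      case 1
      have "dd j (mulx j f) = mulx j (dd j f) + (f - pmuld j (dd j f))"
        by (simp add: dd_mulx pmuld_mulx)
      then show ?thesis using 1 j by (simp add: U.add U.diff mulx_U)
    next
      case 2
      have "dd l (mulx j f) = mulx j (dd l f) + (pmuld l (dd l f) - f)"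
        by (simp add: dd_mulx pmuld_mulx j)
      then show ?thesis using 2 j by (simp add: U.add U.diff mulx_U)
    next
      case 3
      then show ?thesis using j by (simp add: dd_mulx mulx_U)
    qed
  qed
  then have "Euler n (mulx j f) = mulx j (Euler n f) + ?a + (if 1 \<le> l then ?b else 0)"
    using assms j unfolding Euler_def by (simp add: sum.distrib mulx.sum sum.delta)
  also have "(if 1 \<le> l then ?b else 0) = ?b" by (simp add: not_le)
  also have "mulx j (Euler n f) + ?a + ?b = mulx j (Euler n f) + mulx j f
    - U j (pmuld j (dd j f)) + U l (pmuld l (dd l f))"
    by (simp add: j U_Suc[of l f])
  finally show ?thesis by (simp add: j)
qed

text \<open>On coefficient functions \<open>of_nat d\<close> is the constant function d and
  \<open>*\<close> is pointwise, so this is compatibility with scalars.\<close>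

lemma additive_of_nat_mult:
  fixes P :: "'a::ring_1 \<Rightarrow> 'b::ring_1"
  assumes "additive P"
  shows "P (of_nat d * f) = of_nat d * P f"
  by (induction d) (simp_all add: additive.zero[OF assms] additive.add[OF assms] algebra_simps)

text \<open>The part of \<open>f\<close> whose first variable is \<open>x\<^sub>j\<close>, divided by \<open>x\<^sub>j\<close>.\<close>

definition strip :: "nat \<Rightarrow> ipoly \<Rightarrow> ipoly" where
  "strip j f m = (if \<forall>i\<in>{1..<j}. m i = 0 then f (m(j := Suc (m j))) else 0)"

lemma strip_props:
  assumes "homog (Suc d) f" "vars n f" "1 \<le> j"
  shows "homog d (strip j f)" "vars n (strip j f)"
proof -
  have nz: "f (m(j := Suc (m j))) \<noteq> 0" if "strip j f m \<noteq> 0" for m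
    using that by (auto simp: strip_def split: if_splits)
  show "homog d (strip j f)"
    unfolding homog_def
  proof (intro allI impI)
    fix m assume "strip j f m \<noteq> 0"
    define m' where "m' = m(j := Suc (m j))"
    then have *: "finite {i. m' i \<noteq> 0}" "mdeg m' = Suc d"
      using nz \<open>strip j f m \<noteq> 0\<close> assms(1) unfolding homog_def by blast+
    have "m = m'(j := m j)" "m' j = Suc (m j)" by (auto simp: m'_def)
    then show "finite {i. m i \<noteq> 0} \<and> mdeg m = d"
      using mdeg_upd[OF *(1), of j "m j"] *(2) by auto
  qed
  show "vars n (strip j f)"
    unfolding vars_def
  proof (intro allI impI)
    fix m i assume "strip j f m \<noteq> 0" "m i \<noteq> 0"
    moreover from this have "(m(j := Suc (m j))) i \<noteq> 0" by simp
    ultimately show "i \<in> {1..n}" using nz assms(2) unfolding vars_def by blast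
  qed
qed

lemma sum_mulx_strip:
  assumes "homog (Suc d) f" "vars n f"
  shows "f = (\<Sum>j=1..n. mulx j (strip j f))"
proof
  fix m
  have pt: "(\<Sum>j\<in>A. h j) m = (\<Sum>j\<in>A. h j m)" for A :: "nat set" and h :: "nat \<Rightarrow> ipoly"
    by (induction A rule: infinite_finite_induct) (simp_all add: plus_fun_apply zero_fun_apply)
  have *: "mulx j (strip j f) m = (if 0 < m j \<and> (\<forall>i\<in>{1..<j}. m i = 0) then f m else 0)" for j
    by (simp add: mulx_def strip_def)
  show "f m = (\<Sum>j=1..n. mulx j (strip j f)) m"
  proof (cases "f m = 0")
    case True
    then show ?thesis unfolding pt * True by simp
  next
    case False
    then have "mdeg m = Suc d" using assms(1) unfolding homog_def by blast
    then have "mdeg m \<noteq> 0" by simp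
    then have "\<exists>j. m j \<noteq> 0" unfolding mdeg_def by (metis (mono_tags) mem_Collect_eq sum.neutral)
    define l where "l = (LEAST j. m j \<noteq> 0)"
    have l: "m l \<noteq> 0" "\<And>i. i < l \<Longrightarrow> m i = 0"
      unfolding l_def using LeastI_ex[OF \<open>\<exists>j. m j \<noteq> 0\<close>] not_less_Least by blast+
    then have ln: "l \<in> {1..n}" using False assms(2) unfolding vars_def by blast
    have "(0 < m j \<and> (\<forall>i\<in>{1..<j}. m i = 0)) = (j = l)" if "j \<in> {1..n}" for j
      using l ln that by (metis atLeastAtMost_iff atLeastLessThan_iff linorder_neqE_nat not_gr_zero)
    then have "(\<Sum>j=1..n. mulx j (strip j f) m) = (\<Sum>j=1..n. if j = l then f m else 0)"
      unfolding * by (intro sum.cong) auto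
    then show ?thesis using ln by (simp add: pt)
  qed
qed

text \<open>Induction on the degree: f is the sum of the x_j \<open>strip j f\<close>, and by
  \<open>Euler_mulx\<close> each factor x_j adds 1 to the eigenvalue modulo the ideal of null
  elements.\<close>

lemma null_Euler:
  "homog d f \<Longrightarrow> vars (Suc k) f \<Longrightarrow> null k (of_nat d * f - Euler (Suc k) f)"
proof (induction d arbitrary: f)
  case 0
  have "psw i f = f" for i
  proof
    fix m
    have "f m = 0" if "m \<noteq> (\<lambda>_. 0)" for m
    proof (rule ccontr)
      assume "f m \<noteq> 0"
      then have "finite {j. m j \<noteq> 0}" "mdeg m = 0" using 0(1) unfolding homog_def by blast+
      then show False using that by (auto simp: mdeg_def)
    qed
    then show "psw i f m = f m"
      using swapm_eq_0_iff[of i m] by (cases "m = (\<lambda>_. 0)") (simp_all add: psw_def)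
  qed
  then show ?case by (simp add: Euler_def dd_eq_0_iff[THEN iffD2] U.zero null_0)
next
  case (Suc d)
  let ?n = "Suc k"
  have "of_nat (Suc d) * mulx j (strip j f) - Euler ?n (mulx j (strip j f)) =
      mulx j (of_nat d * strip j f - Euler ?n (strip j f)) + U j (pmuld j (dd j (strip j f)))
      - U (j - 1) (pmuld (j - 1) (dd (j - 1) (strip j f)))" if "j \<in> {1..?n}" for j
    using that by (simp add: Euler_mulx mulx.diff additive_of_nat_mult[OF mulx.additive_axioms] algebra_simps)
  moreover have "null k (mulx j (of_nat d * strip j f - Euler ?n (strip j f)) + U j (pmuld j (dd j (strip j f)))
      - U (j - 1) (pmuld (j - 1) (dd (j - 1) (strip j f))))" if "j \<in> {1..?n}" for j
  proof -
    have "null k (of_nat d * strip j f - Euler ?n (strip j f))"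
      using that strip_props[OF Suc.prems] by (intro Suc.IH) auto
    then show ?thesis
      by (rule null_diff[OF null_add[OF null_mulx null_U_pmuld] null_U_pmuld]) (use that in auto)
  qed
  ultimately have "null k (\<Sum>j=1..?n. of_nat (Suc d) * mulx j (strip j f) - Euler ?n (mulx j (strip j f)))"
    by (intro null_sum) (simp only:)
  also have "(\<Sum>j=1..?n. of_nat (Suc d) * mulx j (strip j f) - Euler ?n (mulx j (strip j f)))
      = of_nat (Suc d) * (\<Sum>j=1..?n. mulx j (strip j f)) - Euler ?n (\<Sum>j=1..?n. mulx j (strip j f))"
    by (simp only: sum_subtractf sum_distrib_left Euler.sum)
  also have "(\<Sum>j=1..?n. mulx j (strip j f)) = f"
    using sum_mulx_strip[OF Suc.prems] ..
  finally show ?case .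
qed

text \<open>A negative minimum would lie in J; at its leftmost point the left neighbour is strictly
  larger, contradicting harmonicity. So y \<ge> 0. A zero inside {1..k} also lies in J and forces
  zeros at both neighbours, hence would spread to s.\<close>

lemma discrete_harmonic_pos:
  fixes y :: "nat \<Rightarrow> int"
  assumes ends: "y 0 = 0" "y (Suc k) = 0"
    and pos: "\<And>t. t \<in> {1..k} - J \<Longrightarrow> y t > 0"
    and harm: "\<And>t. t \<in> {1..k} \<inter> J \<Longrightarrow> 2 * y t = y (t - 1) + y (t + 1)"
    and s: "s \<in> {1..k} - J" and t: "t \<in> {1..k}"
  shows "y t > 0"
proof -
  have nonneg: "y i \<ge> 0" if "i \<le> Suc k" for i
  proof (rule ccontr)
    assume i: "\<not> y i \<ge> 0"
    define \<mu> where "\<mu> = Min (y ` {0..Suc k})"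
    have \<mu>: "\<mu> \<le> y i" if "i \<le> Suc k" for i using that unfolding \<mu>_def by (intro Min_le) auto
    have "\<mu> \<in> y ` {0..Suc k}" unfolding \<mu>_def by (intro Min_in) auto
    then have ex: "\<exists>i. i \<le> Suc k \<and> y i = \<mu>" by auto
    define l where "l = (LEAST i. i \<le> Suc k \<and> y i = \<mu>)"
    have l: "l \<le> Suc k" "y l = \<mu>" using LeastI_ex[OF ex] unfolding l_def by blast+
    have less: "y j > \<mu>" if "j < l" for j
    proof -
      have "\<not> (j \<le> Suc k \<and> y j = \<mu>)" using that unfolding l_def by (rule not_less_Least)
      then show ?thesis using that l \<mu>[of j] by auto
    qed
    have neg: "y l < 0" using \<mu>[of i] \<open>i \<le> Suc k\<close> i l by linarith
    then have "l \<noteq> 0" "l \<noteq> Suc k" using ends by (metis less_irrefl)+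
    then have "l \<in> {1..k}" using l by auto
    moreover from this have "l \<in> J" using pos[of l] neg by fastforce
    ultimately have "2 * y l = y (l - 1) + y (l + 1)" using harm by blast
    moreover have "y (l - 1) > \<mu>" using \<open>l \<noteq> 0\<close> by (intro less) auto
    moreover have "y (l + 1) \<ge> \<mu>" using \<open>l \<noteq> Suc k\<close> l by (intro \<mu>) auto
    ultimately show False using l by linarith
  qed
  have zero: "y (i - 1) = 0 \<and> y (i + 1) = 0" if "i \<in> {1..k}" "y i = 0" for i
  proof -
    have "i \<in> J" using pos[of i] that by fastforce
    then have "y (i - 1) + y (i + 1) = 0" using harm[of i] that by simp
    moreover have "y (i - 1) \<ge> 0" "y (i + 1) \<ge> 0" using that by (auto intro!: nonneg)
    ultimately show ?thesis by linarith
  qed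
  show ?thesis
  proof (rule ccontr)
    assume "\<not> y t > 0"
    then have yt: "y t = 0" using nonneg[of t] t by simp
    have up: "y j = 0" if "t \<le> j" "j \<le> Suc k" for j
      using that
    proof (induction j rule: dec_induct)
      case (step j)
      then show ?case using zero[of j] t by simp
    qed (rule yt)
    have down: "y j = 0" if "j \<le> t" for j
      using that
    proof (induction j rule: inc_induct)
      case (step j)
      then show ?case using zero[of "Suc j"] t by simp
    qed (rule yt)
    have "y s = 0" using up[of s] down[of s] s by fastforce
    then show False using pos[OF s] by simp
  qed
qed

text \<open>J collects distinct factors u_t and \<open>as\<close> lists those still to be absorbed.
  A letter outside J enlarges J; for a letter in J, positivity at all t outside J and the minimum
  principle give positivity at that letter. The count k ensures that J is full exactly when no
  letter is left.\<close>

lemma Tsum_words_pos: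
  assumes "J \<subseteq> {1..k}" "set as \<subseteq> {1..k}" "card J + length as = k"
  shows "Tsum k (Finite_Set.fold U (foldr U as pone) J) > 0"
  using assms
proof (induction as arbitrary: J)
  case Nil
  then have "J = {1..k}" by (intro card_subset_eq) auto
  then show ?case by (simp add: Tsum_prod_U[simplified])
next
  case (Cons a as)
  have fin: "finite J" using Cons.prems(1) by (rule finite_subset) simp
  define h where "h = foldr U as pone"
  define y where "y t = Tsum k (U t (Finite_Set.fold U h J))" for t
  have "card J < k" using Cons.prems by simp
  then have "\<not> {1..k} \<subseteq> J" using card_mono[OF fin, of "{1..k}"] by auto
  then obtain s where s: "s \<in> {1..k} - J" by blast
  \<comment> \<open>The relations give \<open>u\<^sub>t (2 u\<^sub>t - u\<^sub>t\<^sub>-\<^sub>1 - u\<^sub>t\<^sub>+\<^sub>1) = 0\<close>, so \<open>y\<close> is harmonic on \<open>J\<close>.\<close>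
  have "y a > 0"
  proof (rule discrete_harmonic_pos)
    show "y 0 = 0" by (simp add: y_def Tsum.zero)
    show "y (Suc k) = 0" by (simp add: y_def Tsum_U_Suc)
    show "y t > 0" if "t \<in> {1..k} - J" for t
    proof -
      have "y t = Tsum k (Finite_Set.fold U h (insert t J))"
        using that fin by (simp add: y_def)
      also have "\<dots> > 0"
        unfolding h_def using that Cons.prems fin by (intro Cons.IH) auto
      finally show ?thesis .
    qed
    show "2 * y t = y (t - 1) + y (t + 1)" if t: "t \<in> {1..k} \<inter> J" for t
    proof -
      define g where "g = Finite_Set.fold U h (J - {t})"
      have g: "Finite_Set.fold U h J = U t g"
        using t fin unfolding g_def by (intro U.fold_rec) auto
      obtain l where l: "t = Suc l" using t by (cases t) auto
      have "0 = Tsum k (U t (pmuld t g))" using t by (simp add: Tsum_U_pmuld)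
      also have "pmuld t g = (U t g - U l g) - (U (Suc t) g - U t g)"
        by (simp add: pmuld_mulx l U_Suc)
      also have "U t \<dots> = (U t (U t g) - U l (U t g)) - (U (Suc t) (U t g) - U t (U t g))"
        by (simp only: U.diff U_commute[of t l] U_commute[of t "Suc t"])
      finally have "0 = (y t - y l) - (y (Suc t) - y t)"
        unfolding y_def g Tsum.diff .
      then show ?thesis using l by simp
    qed
    show "s \<in> {1..k} - J" by (rule s)
    show "a \<in> {1..k}" using Cons.prems by simp
  qed
  then show ?case using fin by (simp add: y_def h_def U.fold_fun_left_comm)
qed

text \<open>Induction on the length, with \<open>as\<close> recording the letters of a reduced word
  already removed. Multiplying by the length replaces the Schubert polynomial by the sum of u_i
  times its divided differences; at the identity, \<open>Tsum_words_pos\<close> applies with J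
  empty.\<close>

lemma Tsum_schubert_pos:
  assumes "w permutes {1..Suc k}" "set as \<subseteq> {1..k}" "plength w + length as = k"
  shows "Tsum k (foldr U as (schubert w)) > 0"
  using assms
proof (induction "plength w" arbitrary: w as)
  case 0
  have "finperm w" using 0 unfolding finperm_def by blast
  then have "\<not> w (Suc i) < w i" for i using plength_descent[of w i] 0 by auto
  then have "w = id" using perm_eq_id 0 by blast
  then have "schubert w = pone" using schubert(1)[OF 0(2)] by (simp only:)
  then show ?case
    using Tsum_words_pos[of "{}" k as] 0 by simp
next
  case (Suc d)
  let ?S = "schubert w"
  have fin: "finperm w" using Suc.prems unfolding finperm_def by blast
  have "null k (foldr U as (of_nat (Suc d) * ?S - Euler (Suc k) ?S))"
    using null_Euler schubert(2,3)[OF Suc.prems(1)] Suc(2) by (intro null_foldr_U) simp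
  then have "Tsum k (foldr U as (of_nat (Suc d) * ?S)) = Tsum k (foldr U as (Euler (Suc k) ?S))"
    by (auto dest: Tsum_null simp: foldr_U.diff Tsum.diff)
  also have "Tsum k (foldr U as (of_nat (Suc d) * ?S)) = of_nat (Suc d) * Tsum k (foldr U as ?S)"
    by (simp only: additive_of_nat_mult[OF foldr_U.additive_axioms] additive_of_nat_mult[OF Tsum.additive_axioms])
  also have "Tsum k (foldr U as (Euler (Suc k) ?S)) = (\<Sum>i=1..Suc k. Tsum k (foldr U (as @ [i]) (dd i ?S)))"
    by (simp only: Euler_def foldr_U.sum Tsum.sum) simp
  finally have eq: "of_nat (Suc d) * Tsum k (foldr U as ?S) = (\<Sum>i=1..Suc k. Tsum k (foldr U (as @ [i]) (dd i ?S)))" .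
  have pos: "Tsum k (foldr U (as @ [i]) (dd i ?S)) > 0" if "w (Suc i) < w i" for i
  proof -
    have i: "1 \<le> i" "i < Suc k" using descent_less[OF Suc.prems(1) that] by auto
    then have "dd i ?S = schubert (w \<circ> sref i)" using schubert(4)[OF Suc.prems(1)] that by simp
    then show ?thesis
      using Suc.hyps(1)[of "w \<circ> sref i" "as @ [i]"] plength_descent[OF fin that] Suc.hyps(2) Suc.prems
        permutes_sref[OF Suc.prems(1) i] i by simp
  qed
  have nonneg: "Tsum k (foldr U (as @ [i]) (dd i ?S)) \<ge> 0" if "1 \<le> i" for i
    using pos[of i] schubert(4)[OF Suc.prems(1) that]
    by (cases "w (Suc i) < w i") (simp_all add: foldr_U.zero U.zero Tsum.zero)
  have "\<exists>i. w (Suc i) < w i"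
  proof (rule ccontr)
    assume "\<not> ?thesis"
    then have "w = id" using perm_eq_id Suc.prems(1) by blast
    then have "plength w = 0" by (auto simp: plength_def card_eq_0_iff)
    then show False using Suc.hyps(2) by simp
  qed
  then obtain i where i: "w (Suc i) < w i" ..
  have "(\<Sum>i=1..Suc k. Tsum k (foldr U (as @ [i]) (dd i ?S))) > 0"
    using pos[OF i] descent_less[OF Suc.prems(1) i] nonneg by (intro sum_pos2[of _ i]) auto
  then have "of_nat (Suc d) * Tsum k (foldr U as ?S) > 0" using eq by simp
  then show ?case by (simp only: zero_less_mult_iff) (simp add: not_less)
qed

text \<open>A positive sum has a positive summand at each level. The index chosen first goes to the
  end of the list, since \<open>foldr\<close> applies the last entry first.\<close>

lemma Tsum_pos_sequence:
  "Tsum k f > 0 \<Longrightarrow> \<exists>is. length is = k \<and> (\<forall>j<k. 1 \<le> is ! j \<and> is ! j \<le> Suc j) \<and> foldr Top is f (\<lambda>_. 0) > 0"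
proof (induction k arbitrary: f)
  case (Suc k)
  have "\<exists>j\<in>{1..Suc k}. Tsum k (Top j f) > 0"
  proof (rule ccontr)
    assume "\<not> ?thesis"
    then have "Tsum (Suc k) f \<le> 0" unfolding Tsum.simps by (intro sum_nonpos) (auto simp: not_less)
    then show False using Suc.prems by simp
  qed
  then obtain j "is" where "j \<in> {1..Suc k}" "length is = k" "\<forall>j<k. 1 \<le> is ! j \<and> is ! j \<le> Suc j"
    "foldr Top is (Top j f) (\<lambda>_. 0) > 0"
    using Suc.IH by blast
  then show ?case
    by (intro exI[of _ "is @ [j]"]) (auto simp: nth_append less_Suc_eq)
qed simp

section \<open>Divided symmetrization\<close>

definition dsden :: "nat \<Rightarrow> (nat \<Rightarrow> real) \<Rightarrow> real" where
  "dsden n y = (\<Prod>k\<in>{1..<n}. y k - y (Suc k))"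

definition mval :: "nat \<Rightarrow> monom \<Rightarrow> (nat \<Rightarrow> real) \<Rightarrow> real" where
  "mval n m y = (\<Prod>j=1..n. y j ^ m j)"

definition dsmono :: "nat \<Rightarrow> monom \<Rightarrow> (nat \<Rightarrow> real) \<Rightarrow> real" where
  "dsmono n m x = (\<Sum>\<sigma> | \<sigma> permutes {1..n}. mval n m (x \<circ> \<sigma>) / dsden n (x \<circ> \<sigma>))"

definition ins :: "nat \<Rightarrow> 'a \<Rightarrow> (nat \<Rightarrow> 'a) \<Rightarrow> nat \<Rightarrow> 'a" where
  "ins i a y j = (if j < i then y j else if j = i then a else y (j - 1))"

definition del :: "nat \<Rightarrow> monom \<Rightarrow> monom" where
  "del i m j = (if j < i then m j else m (Suc j))"

lemma dsden_Suc: "1 \<le> n \<Longrightarrow> dsden (Suc n) y = dsden n y * (y n - y (Suc n))"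
  unfolding dsden_def by (simp add: prod.atLeastLessThan_Suc)

lemma dsden_cong: "(\<And>j. 1 \<le> j \<Longrightarrow> j \<le> n \<Longrightarrow> y j = z j) \<Longrightarrow> dsden n y = dsden n z"
  unfolding dsden_def by (intro prod.cong) auto

lemma mval_cong: "(\<And>j. 1 \<le> j \<Longrightarrow> j \<le> n \<Longrightarrow> y j = z j) \<Longrightarrow> mval n m y = mval n m z"
  unfolding mval_def by (intro prod.cong) auto

lemma mval_Suc: "mval (Suc n) m y = mval n m y * y (Suc n) ^ m (Suc n)"
  by (simp add: mval_def)

text \<open>Partial fractions: \<open>(u - v) / ((u - a) * (a - v)) = 1 / (u - a) - 1 / (v - a)\<close>.\<close>

lemma inverse_dsden_ins:
  assumes "\<And>j. 1 \<le> j \<Longrightarrow> j \<le> n \<Longrightarrow> y j \<noteq> a"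
    and "\<And>j. 1 \<le> j \<Longrightarrow> j < n \<Longrightarrow> y j \<noteq> y (Suc j)"
    and "1 \<le> n" "1 \<le> i" "i \<le> Suc n"
  shows "1 / dsden (Suc n) (ins i a y) =
    ((if 1 < i then 1 / (y (i - 1) - a) else 0) - (if i \<le> n then 1 / (y i - a) else 0)) / dsden n y"
  using assms(3,1,2,4,5)
proof (induction n arbitrary: i rule: dec_induct)
  case base
  then consider "i = 1" | "i = 2" by fastforce
  then show ?case
  proof cases
    case 1
    then show ?thesis using base(1)[of 1] by (simp add: dsden_def ins_def field_simps)
  next
    case 2
    then show ?thesis by (simp add: dsden_def ins_def numeral_2_eq_2)
  qed
next
  case (step n)
  have ne: "y n \<noteq> a" "y (Suc n) \<noteq> a" "y n \<noteq> y (Suc n)" using step.prems(1,2) step.hyps by auto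
  \<comment> \<open>The inserted value stands last, directly before the last entry, or earlier. Only
    the second case uses partial fractions; in the third the final factor is unaffected.\<close>
  consider "i = Suc (Suc n)" | "i = Suc n" | "i \<le> n" using step.prems(4) by linarith
  then show ?case
  proof cases
    case 1
    have "dsden (Suc n) (ins i a y) = dsden (Suc n) y"
      by (rule dsden_cong) (simp add: ins_def 1)
    then have "dsden (Suc (Suc n)) (ins i a y) = dsden (Suc n) y * (y (Suc n) - a)"
      using 1 by (simp add: dsden_Suc[of "Suc n"] ins_def)
    then show ?thesis using 1 by simp
  next
    case 2
    have "dsden n (ins i a y) = dsden n y"
      by (rule dsden_cong) (simp add: ins_def 2)
    then have "dsden (Suc (Suc n)) (ins i a y) = dsden n y * (y n - a) * (a - y (Suc n))"
      using 2 step.hyps by (simp add: dsden_Suc ins_def)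
    then have "1 / dsden (Suc (Suc n)) (ins i a y) = 1 / ((y n - a) * (a - y (Suc n))) / dsden n y"
      by (simp add: mult.assoc)
    also have "1 / ((y n - a) * (a - y (Suc n))) = (1 / (y n - a) - 1 / (y (Suc n) - a)) / (y n - y (Suc n))"
      using ne by (simp add: divide_simps) (simp add: algebra_simps)
    also have "\<dots> / dsden n y = (1 / (y n - a) - 1 / (y (Suc n) - a)) / dsden (Suc n) y"
      using step.hyps by (simp add: dsden_Suc mult.commute)
    finally show ?thesis using 2 step.hyps by simp
  next
    case 3
    have "dsden (Suc (Suc n)) (ins i a y) = dsden (Suc n) (ins i a y) * (y n - y (Suc n))"
      using 3 by (simp add: dsden_Suc[of "Suc n"] ins_def)
    then have "1 / dsden (Suc (Suc n)) (ins i a y) = 1 / dsden (Suc n) (ins i a y) / (y n - y (Suc n))"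
      by simp
    also have "1 / dsden (Suc n) (ins i a y) =
        ((if 1 < i then 1 / (y (i - 1) - a) else 0) - (if i \<le> n then 1 / (y i - a) else 0)) / dsden n y"
      using step.prems 3 by (intro step.IH) auto
    finally show ?thesis using 3 step.hyps by (simp add: dsden_Suc)
  qed
qed

lemma mval_ins:
  "1 \<le> i \<Longrightarrow> i \<le> Suc n \<Longrightarrow> mval (Suc n) m (ins i a y) = a ^ m i * mval n (del i m) y"
proof (induction n)
  case 0
  then have "i = Suc 0" by simp
  then show ?case by (simp add: mval_def ins_def)
next
  case (Suc n)
  show ?case
  proof (cases "i = Suc (Suc n)")
    case True
    have "mval (Suc n) m (ins i a y) = mval (Suc n) m y" by (rule mval_cong) (simp add: ins_def True)
    moreover have "mval (Suc n) m y = mval (Suc n) (del i m) y"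
      unfolding mval_def by (intro prod.cong) (auto simp: del_def True)
    moreover have "ins i a y (Suc (Suc n)) = a" by (simp add: ins_def True)
    ultimately show ?thesis using True by (simp add: mval_Suc[of "Suc n" m])
  next
    case False
    then have "mval (Suc n) m (ins i a y) = a ^ m i * mval n (del i m) y" using Suc by simp
    moreover have "ins i a y (Suc (Suc n)) = y (Suc n)" "del i m (Suc n) = m (Suc (Suc n))"
      using False Suc.prems by (simp_all add: ins_def del_def)
    ultimately show ?thesis by (simp add: mval_Suc[of "Suc n" m] mval_Suc[of n "del i m"])
  qed
qed

lemma mval_upd:
  assumes "1 \<le> i" "i \<le> n"
  shows "mval n (m(i := t)) y = y i ^ t * (\<Prod>j\<in>{1..n} - {i}. y j ^ m j)"
  unfolding mval_def using assms by (subst prod.remove[of _ i]) auto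

text \<open>Exact division by y - a through telescoping powers. At least one of the two sums is
  empty, so one formula covers both orders of the exponents.\<close>

lemma power_exchange_diff:
  fixes y a :: real
  shows "y ^ p * a ^ q - y ^ q * a ^ p =
    (y - a) * ((\<Sum>t=q..<p. a ^ (p + q - 1 - t) * y ^ t) - (\<Sum>t=p..<q. a ^ (p + q - 1 - t) * y ^ t))"
proof -
  have *: "y ^ p * a ^ q - y ^ q * a ^ p = (y - a) * (\<Sum>t=q..<p. a ^ (p + q - 1 - t) * y ^ t)"
    if "q \<le> p" for p q
  proof -
    let ?h = "\<lambda>t. y ^ t * a ^ (p + q - t)"
    have "(y - a) * (\<Sum>t=q..<p. a ^ (p + q - 1 - t) * y ^ t) = (\<Sum>t=q..<p. ?h (Suc t) - ?h t)"
      unfolding sum_distrib_left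
    proof (rule sum.cong)
      fix t assume "t \<in> {q..<p}"
      then have e: "p + q - t = Suc (p + q - 1 - t)" "p + q - Suc t = p + q - 1 - t" by auto
      show "(y - a) * (a ^ (p + q - 1 - t) * y ^ t) = ?h (Suc t) - ?h t"
        unfolding e power_Suc by (simp only: left_diff_distrib mult_ac)
    qed simp
    also have "\<dots> = ?h p - ?h q" by (rule sum_Suc_diff'[OF that])
    finally show ?thesis by simp
  qed
  show ?thesis
  proof (cases "q \<le> p")
    case True
    then show ?thesis using * by simp
  next
    case False
    then show ?thesis using *[of p q] by (simp add: add.commute algebra_simps)
  qed
qed

text \<open>\<open>\<tau> \<circ> cyc (Suc n) i\<close> is the word \<open>\<tau>\<close> with the letter \<open>Suc n\<close> inserted at position \<open>i\<close>.\<close>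

definition cyc :: "nat \<Rightarrow> nat \<Rightarrow> nat \<Rightarrow> nat" where
  "cyc n i j = (if j < i then j else if j = i then n else if j \<le> n then j - 1 else j)"

definition cyc' :: "nat \<Rightarrow> nat \<Rightarrow> nat \<Rightarrow> nat" where
  "cyc' n i j = (if j < i then j else if j = n then i else if j < n then Suc j else j)"

lemma cyc_cyc': "i \<le> n \<Longrightarrow> cyc n i (cyc' n i j) = j" "i \<le> n \<Longrightarrow> cyc' n i (cyc n i j) = j"
  by (auto simp: cyc_def cyc'_def)

lemma cyc_permutes: "1 \<le> i \<Longrightarrow> i \<le> n \<Longrightarrow> cyc n i permutes {1..n}"
  "1 \<le> i \<Longrightarrow> i \<le> n \<Longrightarrow> cyc' n i permutes {1..n}"
proof -
  assume i: "1 \<le> i" "i \<le> n"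
  then have "bij (cyc n i)" "bij (cyc' n i)"
    using cyc_cyc'[of i n] by (auto intro!: o_bij[of "cyc' n i" "cyc n i"] o_bij[of "cyc n i" "cyc' n i"] simp: fun_eq_iff)
  then show "cyc n i permutes {1..n}" "cyc' n i permutes {1..n}"
    using i unfolding permutes_def bij_iff by (auto simp: cyc_def cyc'_def)
qed

text \<open>A permutation is determined by the position of its largest letter and the word left
  after removing that letter; \<open>cyc'\<close> does the removal.\<close>

lemma sum_permutes_insert_last:
  fixes g :: "(nat \<Rightarrow> nat) \<Rightarrow> 'a::comm_monoid_add"
  shows "(\<Sum>\<sigma> | \<sigma> permutes {1..Suc n}. g \<sigma>) =
    (\<Sum>\<tau> | \<tau> permutes {1..n}. \<Sum>i=1..Suc n. g (\<tau> \<circ> cyc (Suc n) i))"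
proof -
  let ?N = "Suc n"
  let ?P = "\<lambda>n :: nat. {\<sigma>. \<sigma> permutes {1..n}}"
  have fin: "finite (?P n)" for n by (rule finite_permutations) simp
  have up: "\<tau> permutes {1..?N}" "\<tau> ?N = ?N" if "\<tau> permutes {1..n}" for \<tau>
    using permutes_subset[OF that, of "{1..?N}"] permutes_not_in[OF that, of ?N] by auto
  have down: "\<sigma> \<circ> cyc' ?N (inv \<sigma> ?N) permutes {1..n}" "inv \<sigma> ?N \<in> {1..?N}" if "\<sigma> permutes {1..?N}" for \<sigma>
  proof -
    have i: "inv \<sigma> ?N \<in> {1..?N}" using permutes_in_image[OF permutes_inv[OF that], of ?N] by simp
    then show "inv \<sigma> ?N \<in> {1..?N}" .
    have "\<sigma> \<circ> cyc' ?N (inv \<sigma> ?N) permutes {1..?N}"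
      using i that by (intro permutes_compose cyc_permutes) auto
    moreover have "(\<sigma> \<circ> cyc' ?N (inv \<sigma> ?N)) j = j" if "j \<in> {1..?N} - {1..n}" for j
    proof -
      have "j = ?N" using that by auto
      then show ?thesis using i permutes_inverses(1)[OF \<open>\<sigma> permutes {1..?N}\<close>] by (auto simp: cyc'_def)
    qed
    ultimately show "\<sigma> \<circ> cyc' ?N (inv \<sigma> ?N) permutes {1..n}" by (rule permutes_superset)
  qed
  have inv: "inv (\<tau> \<circ> cyc ?N i) ?N = i" if "\<tau> permutes {1..n}" "i \<in> {1..?N}" for \<tau> i
  proof -
    have "\<tau> \<circ> cyc ?N i permutes {1..?N}"
      using that by (intro permutes_compose cyc_permutes up) auto
    then show ?thesis using up(2)[OF that(1)] by (simp add: permutes_inv_eq cyc_def)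
  qed
  have "(\<Sum>\<tau>\<in>?P n. \<Sum>i=1..?N. g (\<tau> \<circ> cyc ?N i)) = (\<Sum>(\<tau>, i)\<in>?P n \<times> {1..?N}. g (\<tau> \<circ> cyc ?N i))"
    using fin by (intro sum.cartesian_product)
  also have "\<dots> = (\<Sum>\<sigma>\<in>?P ?N. g \<sigma>)"
  proof (rule sum.reindex_bij_witness[where
        i = "\<lambda>\<sigma>. (\<sigma> \<circ> cyc' ?N (inv \<sigma> ?N), inv \<sigma> ?N)" and j = "\<lambda>(\<tau>, i). \<tau> \<circ> cyc ?N i"])
    fix p assume p: "p \<in> ?P n \<times> {1..?N}"
    then obtain \<tau> i where [simp]: "p = (\<tau>, i)" and \<tau>: "\<tau> permutes {1..n}" "i \<in> {1..?N}" by auto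
    show "((case p of (\<tau>, i) \<Rightarrow> \<tau> \<circ> cyc ?N i) \<circ> cyc' ?N (inv (case p of (\<tau>, i) \<Rightarrow> \<tau> \<circ> cyc ?N i) ?N),
        inv (case p of (\<tau>, i) \<Rightarrow> \<tau> \<circ> cyc ?N i) ?N) = p"
      using inv[OF \<tau>] \<tau>(2) by (auto simp: fun_eq_iff cyc_cyc' simp del: o_apply simp: o_def)
    show "(case p of (\<tau>, i) \<Rightarrow> \<tau> \<circ> cyc ?N i) \<in> ?P ?N"
      using permutes_compose[OF cyc_permutes(1)[of i ?N] up(1)[OF \<tau>(1)]] \<tau>(2) by simp
    show "g (case p of (\<tau>, i) \<Rightarrow> \<tau> \<circ> cyc ?N i) = (case p of (\<tau>, i) \<Rightarrow> g (\<tau> \<circ> cyc ?N i))" by simp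
  next
    fix \<sigma> assume "\<sigma> \<in> ?P ?N"
    then have \<sigma>: "\<sigma> permutes {1..?N}" by simp
    show "(case (\<sigma> \<circ> cyc' ?N (inv \<sigma> ?N), inv \<sigma> ?N) of (\<tau>, i) \<Rightarrow> \<tau> \<circ> cyc ?N i) = \<sigma>"
      using down[OF \<sigma>] by (auto simp: fun_eq_iff cyc_cyc')
    show "(\<sigma> \<circ> cyc' ?N (inv \<sigma> ?N), inv \<sigma> ?N) \<in> ?P n \<times> {1..?N}"
      using down[OF \<sigma>] by simp
  qed
  finally show ?thesis ..
qed

section \<open>Recursion for divided symmetrization of monomials\<close>

lemma dsmono_cong_ins:
  assumes "\<tau> permutes {1..n}" "1 \<le> i" "i \<le> Suc n" "1 \<le> j" "j \<le> Suc n"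
  shows "x ((\<tau> \<circ> cyc (Suc n) i) j) = ins i (x (Suc n)) (x \<circ> \<tau>) j"
  using assms permutes_not_in[OF assms(1), of "Suc n"] by (auto simp: cyc_def ins_def)

text \<open>By partial fractions, the denominator y_i - a comes from inserting a directly before and
  directly after y_i. The two numerators differ by exchanging two exponents, so their difference is
  divisible by y_i - a and a symmetrization in n variables remains.\<close>

lemma dsmono_Suc:
  assumes x: "inj_on x {1..Suc n}" and n: "1 \<le> n"
  defines "a \<equiv> x (Suc n)"
  shows "dsmono (Suc n) m x = (\<Sum>i=1..n.
    (\<Sum>t=m (Suc i)..<m i. a ^ (m i + m (Suc i) - 1 - t) * dsmono n ((del i m)(i := t)) x)
    - (\<Sum>t=m i..<m (Suc i). a ^ (m i + m (Suc i) - 1 - t) * dsmono n ((del i m)(i := t)) x))"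
proof -
  let ?e = "\<lambda>i t. a ^ (m i + m (Suc i) - 1 - t)" and ?m = "\<lambda>i t. (del i m)(i := t)"
  have inner: "(\<Sum>i=1..Suc n. mval (Suc n) m (x \<circ> (\<tau> \<circ> cyc (Suc n) i)) / dsden (Suc n) (x \<circ> (\<tau> \<circ> cyc (Suc n) i)))
    = (\<Sum>i=1..n. (\<Sum>t=m (Suc i)..<m i. ?e i t * (mval n (?m i t) (x \<circ> \<tau>) / dsden n (x \<circ> \<tau>)))
      - (\<Sum>t=m i..<m (Suc i). ?e i t * (mval n (?m i t) (x \<circ> \<tau>) / dsden n (x \<circ> \<tau>))))"
    if \<tau>: "\<tau> permutes {1..n}" for \<tau>
  proof -
    define y where "y = x \<circ> \<tau>"
    define P where "P i = mval (Suc n) m (ins i a y)" for i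
    have \<tau>_in: "\<tau> j \<in> {1..n}" if "1 \<le> j" "j \<le> n" for j
      using permutes_in_image[OF \<tau>, of j] that by simp
    have ya: "y j \<noteq> a" if "1 \<le> j" "j \<le> n" for j
      using inj_onD[OF x, of "\<tau> j" "Suc n"] \<tau>_in[OF that] by (auto simp: y_def a_def)
    have yy: "y j \<noteq> y (Suc j)" if "1 \<le> j" "j < n" for j
      using inj_onD[OF x, of "\<tau> j" "\<tau> (Suc j)"] \<tau>_in[of j] \<tau>_in[of "Suc j"] that
        injD[OF permutes_inj[OF \<tau>], of j "Suc j"] by (auto simp: y_def)
    have PQ: "mval (Suc n) m (x \<circ> (\<tau> \<circ> cyc (Suc n) i)) / dsden (Suc n) (x \<circ> (\<tau> \<circ> cyc (Suc n) i))
      = ((if 1 < i then P i / (y (i - 1) - a) else 0) - (if i \<le> n then P i / (y i - a) else 0)) / dsden n y"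
      if "i \<in> {1..Suc n}" for i
    proof -
      have "mval (Suc n) m (x \<circ> (\<tau> \<circ> cyc (Suc n) i)) = P i"
        unfolding P_def y_def a_def using that dsmono_cong_ins[OF \<tau>, of i _ x] by (intro mval_cong) simp
      moreover have "dsden (Suc n) (x \<circ> (\<tau> \<circ> cyc (Suc n) i)) = dsden (Suc n) (ins i a y)"
        unfolding y_def a_def using that dsmono_cong_ins[OF \<tau>, of i _ x] by (intro dsden_cong) simp
      moreover have "P i / dsden (Suc n) (ins i a y) = P i * (1 / dsden (Suc n) (ins i a y))" by simp
      moreover have "1 / dsden (Suc n) (ins i a y) =
        ((if 1 < i then 1 / (y (i - 1) - a) else 0) - (if i \<le> n then 1 / (y i - a) else 0)) / dsden n y"
        using that n ya yy by (intro inverse_dsden_ins) auto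
      ultimately show ?thesis by (simp only:) (simp add: right_diff_distrib)
    qed
    \<comment> \<open>Regroup by the denominator y_i - a instead of by the insertion
      position.\<close>
    have "(\<Sum>i=1..Suc n. mval (Suc n) m (x \<circ> (\<tau> \<circ> cyc (Suc n) i)) / dsden (Suc n) (x \<circ> (\<tau> \<circ> cyc (Suc n) i)))
      = ((\<Sum>i=1..Suc n. if 1 < i then P i / (y (i - 1) - a) else 0)
         - (\<Sum>i=1..Suc n. if i \<le> n then P i / (y i - a) else 0)) / dsden n y"
      by (simp only: PQ cong: sum.cong) (simp only: sum_subtractf sum_divide_distrib[symmetric])
    also have "(\<Sum>i=1..Suc n. if i \<le> n then P i / (y i - a) else 0) = (\<Sum>i=1..n. P i / (y i - a))"
      by simp
    also have "(\<Sum>i=1..Suc n. if 1 < i then P i / (y (i - 1) - a) else 0) = (\<Sum>i=1..n. P (Suc i) / (y i - a))"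
    proof -
      define f where "f i = (if 1 < i then P i / (y (i - 1) - a) else 0)" for i
      have "(\<Sum>i=1..Suc n. f i) = (\<Sum>i=0..n. f (Suc i))"
        using sum.shift_bounds_cl_Suc_ivl[of f 0 n] by (simp only: One_nat_def)
      also have "\<dots> = (\<Sum>i=1..n. P (Suc i) / (y i - a))"
        by (rule sum.mono_neutral_cong_right) (auto simp: f_def)
      finally have "(\<Sum>i=1..Suc n. f i) = (\<Sum>i=1..n. P (Suc i) / (y i - a))" .
      then show ?thesis unfolding f_def .
    qed
    also have "((\<Sum>i=1..n. P (Suc i) / (y i - a)) - (\<Sum>i=1..n. P i / (y i - a))) / dsden n y
      = (\<Sum>i=1..n. (P (Suc i) - P i) / (y i - a) / dsden n y)"
      by (simp only: sum_subtractf[symmetric] sum_divide_distrib diff_divide_distrib)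
    also have "\<dots> = (\<Sum>i=1..n. (\<Sum>t=m (Suc i)..<m i. ?e i t * (mval n (?m i t) y / dsden n y))
      - (\<Sum>t=m i..<m (Suc i). ?e i t * (mval n (?m i t) y / dsden n y)))"
    proof (rule sum.cong)
      fix i assume i: "i \<in> {1..n}"
      define R where "R = (\<Prod>j\<in>{1..n} - {i}. y j ^ del i m j)"
      have mv: "mval n (?m i t) y = y i ^ t * R" for t
        unfolding R_def using i by (intro mval_upd) auto
      \<comment> \<open>Deleting slot i or slot i+1 leaves the same exponents except at i.\<close>
      have d: "del (Suc i) m = ?m i (m i)" "del i m = ?m i (m (Suc i))"
        by (auto simp: del_def fun_eq_iff less_Suc_eq)
      have "mval n (del (Suc i) m) y = y i ^ m i * R" "mval n (del i m) y = y i ^ m (Suc i) * R"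
        by (subst d, rule mv)+
      then have "P (Suc i) = a ^ m (Suc i) * (y i ^ m i * R)" "P i = a ^ m i * (y i ^ m (Suc i) * R)"
        unfolding P_def using i mval_ins[of "Suc i" n m a y] mval_ins[of i n m a y] by simp_all
      then have "P (Suc i) - P i = (y i ^ m i * a ^ m (Suc i) - y i ^ m (Suc i) * a ^ m i) * R"
        by (simp add: algebra_simps)
      also have "\<dots> = (y i - a) * ((\<Sum>t=m (Suc i)..<m i. ?e i t * y i ^ t)
        - (\<Sum>t=m i..<m (Suc i). ?e i t * y i ^ t)) * R"
        by (simp only: power_exchange_diff)
      finally have "(P (Suc i) - P i) / (y i - a) = ((\<Sum>t=m (Suc i)..<m i. ?e i t * y i ^ t)
        - (\<Sum>t=m i..<m (Suc i). ?e i t * y i ^ t)) * R"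
        using ya[of i] i by simp
      then show "(P (Suc i) - P i) / (y i - a) / dsden n y =
        (\<Sum>t=m (Suc i)..<m i. ?e i t * (mval n (?m i t) y / dsden n y))
        - (\<Sum>t=m i..<m (Suc i). ?e i t * (mval n (?m i t) y / dsden n y))"
        by (simp add: mv left_diff_distrib diff_divide_distrib sum_distrib_right sum_divide_distrib mult.assoc)
    qed simp
    finally show ?thesis unfolding y_def .
  qed
  let ?v = "\<lambda>\<tau> i t. ?e i t * (mval n (?m i t) (x \<circ> \<tau>) / dsden n (x \<circ> \<tau>))"
  have "dsmono (Suc n) m x = (\<Sum>\<tau> | \<tau> permutes {1..n}. \<Sum>i=1..n.
      (\<Sum>t=m (Suc i)..<m i. ?v \<tau> i t) - (\<Sum>t=m i..<m (Suc i). ?v \<tau> i t))"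
    unfolding dsmono_def sum_permutes_insert_last
    by (rule sum.cong[OF refl]) (rule inner, simp)
  also have "\<dots> = (\<Sum>i=1..n. \<Sum>\<tau> | \<tau> permutes {1..n}.
      (\<Sum>t=m (Suc i)..<m i. ?v \<tau> i t) - (\<Sum>t=m i..<m (Suc i). ?v \<tau> i t))"
    by (rule sum.swap)
  also have "\<dots> = (\<Sum>i=1..n. (\<Sum>t=m (Suc i)..<m i. ?e i t * dsmono n (?m i t) x)
      - (\<Sum>t=m i..<m (Suc i). ?e i t * dsmono n (?m i t) x))"
  proof (rule sum.cong[OF refl])
    fix i
    have "(\<Sum>\<tau> | \<tau> permutes {1..n}. \<Sum>t\<in>s. ?v \<tau> i t) = (\<Sum>t\<in>s. ?e i t * dsmono n (?m i t) x)" for s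
      by (subst sum.swap) (simp only: dsmono_def sum_distrib_left)
    then show "(\<Sum>\<tau> | \<tau> permutes {1..n}. (\<Sum>t=m (Suc i)..<m i. ?v \<tau> i t) - (\<Sum>t=m i..<m (Suc i). ?v \<tau> i t))
      = (\<Sum>t=m (Suc i)..<m i. ?e i t * dsmono n (?m i t) x) - (\<Sum>t=m i..<m (Suc i). ?e i t * dsmono n (?m i t) x)"
      by (simp only: sum_subtractf)
  qed
  finally show ?thesis .
qed

section \<open>Comparison of divided symmetrization with L\<close>

definition pmono :: "monom \<Rightarrow> ipoly" where
  "pmono m m' = (if m' = m then 1 else 0)"

lemma homog_Top:
  assumes "homog d f"
  shows "homog (d - 1) (Top i f)"
  unfolding homog_def
proof (intro allI impI)
  fix m assume "Top i f m \<noteq> 0"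
  then obtain l where "f (ins0 l (m(i := Suc (m i)))) \<noteq> 0"
    unfolding Top_def Rop_def by (metis diff_self)
  then have "finite {j. ins0 l (m(i := Suc (m i))) j \<noteq> 0}" "mdeg (ins0 l (m(i := Suc (m i)))) = d"
    using assms unfolding homog_def by blast+
  then have *: "finite {j. (m(i := Suc (m i))) j \<noteq> 0}" "mdeg (m(i := Suc (m i))) = d"
    unfolding finite_ins0_support mdeg_ins0 .
  define m' where "m' = m(i := Suc (m i))"
  have "m = m'(i := m i)" "m' i = Suc (m i)" by (auto simp: m'_def)
  then show "finite {j. m j \<noteq> 0} \<and> mdeg m = d - 1"
    using mdeg_upd[of m' i "m i"] * unfolding m'_def[symmetric] by auto
qed

lemma homog_0_Top: "homog 0 f \<Longrightarrow> Top i f = 0"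
proof
  fix m assume f: "homog 0 f"
  have "f m' = 0" if "m' j \<noteq> 0" for m' j
    using f that unfolding homog_def mdeg_def by (metis (mono_tags, lifting) mem_Collect_eq sum_eq_0_iff)
  moreover have "ins0 (Suc i) (m(i := Suc (m i))) i \<noteq> 0" "ins0 i (m(i := Suc (m i))) (Suc i) \<noteq> 0"
    by (simp_all add: ins0_def)
  ultimately show "Top i f m = 0 m" unfolding Top_def Rop_def zero_fun_def by (metis diff_self)
qed

text \<open>Each T_j lowers the degree by 1 and kills degree 0, so k of them yield a constant term
  only from degree k.\<close>

lemma Tsum_homog: "homog d f \<Longrightarrow> d \<noteq> k \<Longrightarrow> Tsum k f = 0"
proof (induction k arbitrary: d f)
  case 0
  then have "f (\<lambda>_. 0) = 0" unfolding homog_def by (force simp: mdeg_def)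
  then show ?case by simp
next
  case (Suc k)
  show ?case
  proof (cases "d = 0")
    case True
    then show ?thesis using Suc.prems homog_0_Top by (simp add: Tsum.zero del: sum.cl_ivl_Suc)
  next
    case False
    then show ?thesis using Suc.IH[OF homog_Top[OF Suc.prems(1)]] Suc.prems(2)
      by (simp del: sum.cl_ivl_Suc)
  qed
qed

lemma homog_pmono: "finite {j. m j \<noteq> 0} \<Longrightarrow> homog (mdeg m) (pmono m)"
  by (simp add: homog_def pmono_def)

text \<open>R_{i+1} retains only monomials free of x_{i+1}, and R_i only those free of x_i; the
  division by x_i then needs the other exponent to be positive.\<close>

lemma Top_pmono:
  "Top i (pmono m) =
    (if m (Suc i) = 0 \<and> 0 < m i then pmono ((del i m)(i := m i - 1)) else 0)
    - (if m i = 0 \<and> 0 < m (Suc i) then pmono ((del i m)(i := m (Suc i) - 1)) else 0)"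
proof
  fix m'
  have 1: "ins0 (Suc i) (m'(i := Suc (m' i))) = m \<longleftrightarrow>
      m (Suc i) = 0 \<and> 0 < m i \<and> m' = (del i m)(i := m i - 1)"
  proof (intro iffI)
    assume m: "ins0 (Suc i) (m'(i := Suc (m' i))) = m"
    show "m (Suc i) = 0 \<and> 0 < m i \<and> m' = (del i m)(i := m i - 1)"
      unfolding m[symmetric] by (auto simp: fun_eq_iff ins0_def del_def)
  next
    assume "m (Suc i) = 0 \<and> 0 < m i \<and> m' = (del i m)(i := m i - 1)"
    then show "ins0 (Suc i) (m'(i := Suc (m' i))) = m"
      by (auto simp: fun_eq_iff ins0_def del_def less_Suc_eq)
  qed
  have 2: "ins0 i (m'(i := Suc (m' i))) = m \<longleftrightarrow>
      m i = 0 \<and> 0 < m (Suc i) \<and> m' = (del i m)(i := m (Suc i) - 1)"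
  proof (intro iffI)
    assume m: "ins0 i (m'(i := Suc (m' i))) = m"
    show "m i = 0 \<and> 0 < m (Suc i) \<and> m' = (del i m)(i := m (Suc i) - 1)"
      unfolding m[symmetric] by (auto simp: fun_eq_iff ins0_def del_def)
  next
    assume a: "m i = 0 \<and> 0 < m (Suc i) \<and> m' = (del i m)(i := m (Suc i) - 1)"
    show "ins0 i (m'(i := Suc (m' i))) = m"
    proof
      fix j
      consider "j < i" | "j = i" | "j = Suc i" | "Suc i < j" by linarith
      then show "ins0 i (m'(i := Suc (m' i))) j = m j"
        using a by cases (auto simp: ins0_def del_def)
    qed
  qed
  show "Top i (pmono m) m' = ((if m (Suc i) = 0 \<and> 0 < m i then pmono ((del i m)(i := m i - 1)) else 0)
    - (if m i = 0 \<and> 0 < m (Suc i) then pmono ((del i m)(i := m (Suc i) - 1)) else 0)) m'"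
    unfolding Top_def Rop_def pmono_def[of m] 1 2 by (simp add: minus_apply zero_fun_apply pmono_def)
qed

lemma mdeg_del:
  assumes "finite {j. m j \<noteq> 0}"
  shows "finite {j. ((del i m)(i := t)) j \<noteq> 0}" "mdeg ((del i m)(i := t)) + m i + m (Suc i) = mdeg m + t"
proof -
  have "ins0 i (del i m) = m(i := 0)"
    by (auto simp: fun_eq_iff ins0_def del_def)
  then have "finite {j. del i m j \<noteq> 0}" "mdeg (del i m) + m i = mdeg m"
    using mdeg_upd[OF assms, of i 0] finite_ins0_support[of i "del i m"] mdeg_ins0[of i "del i m"] by simp_all
  then show "finite {j. ((del i m)(i := t)) j \<noteq> 0}" "mdeg ((del i m)(i := t)) + m i + m (Suc i) = mdeg m + t"
    using mdeg_upd[of "del i m" i t] by (simp_all add: del_def)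
qed

text \<open>Induction through \<open>dsmono_Suc\<close>: terms of degree below k vanish, and the
  surviving ones are those of \<open>Top_pmono\<close>, so a disappears. Bounding the degree instead
  of fixing it keeps the vanishing terms within the induction hypothesis.\<close>

lemma dsmono_eq_Tsum:
  assumes "\<And>j. m j \<noteq> 0 \<Longrightarrow> j \<in> {1..Suc k}" "mdeg m \<le> k" "inj_on x {1..Suc k}"
  shows "dsmono (Suc k) m x = of_int (Tsum k (pmono m))"
  using assms
proof (induction k arbitrary: m x)
  case 0
  have fin: "finite {j. m j \<noteq> 0}" by (rule finite_subset[of _ "{1..Suc 0}"]) (use 0(1) in auto)
  then have m: "m = (\<lambda>_. 0)" using 0(2) by (auto simp: mdeg_def)
  have "{\<sigma>. \<sigma> permutes {1..Suc 0}} = {id}" by auto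
  then show ?case by (simp add: dsmono_def mval_def dsden_def m pmono_def)
next
  case (Suc k)
  let ?n = "Suc k"
  define a where "a = x (Suc ?n)"
  define D where "D i t = Tsum k (pmono ((del i m)(i := t)))" for i t
  have fin: "finite {j. m j \<noteq> 0}" by (rule finite_subset[of _ "{1..Suc ?n}"]) (use Suc.prems(1) in auto)
  have inj: "inj_on x {1..?n}" using Suc.prems(3) by (rule inj_on_subset) auto
  have ds: "dsmono ?n ((del i m)(i := t)) x = of_int (D i t)"
    if "i \<in> {1..?n}" "t < m i \<or> t < m (Suc i)" for i t
    unfolding D_def
  proof (rule Suc.IH[OF _ _ inj])
    show "mdeg ((del i m)(i := t)) \<le> k"
      using mdeg_del(2)[OF fin, of i t] Suc.prems(2) that(2) by linarith
    show "j \<in> {1..?n}" if "((del i m)(i := t)) j \<noteq> 0" for j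
      using Suc.prems(1)[of j] Suc.prems(1)[of "Suc j"] that \<open>i \<in> {1..?n}\<close>
      by (auto simp: del_def split: if_splits)
  qed
  have D0: "D i t = 0" if "Suc t < m i + m (Suc i)" for i t
    unfolding D_def
  proof (rule Tsum_homog)
    show "homog (mdeg ((del i m)(i := t))) (pmono ((del i m)(i := t)))"
      by (rule homog_pmono) (rule mdeg_del(1)[OF fin])
    show "mdeg ((del i m)(i := t)) \<noteq> k"
      using mdeg_del(2)[OF fin, of i t] Suc.prems(2) that by linarith
  qed
  \<comment> \<open>By \<open>D0\<close> only t = p + q - 1 can contribute; it lies below p only if
    q = 0, and there the power of a is 1.\<close>
  have S: "(\<Sum>t=q..<p. a ^ (p + q - 1 - t) * of_int (D i t)) = of_int (if q = 0 \<and> 0 < p then D i (p - 1) else 0)"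
    if "p + q = m i + m (Suc i)" for p q i
  proof (cases "q = 0 \<and> 0 < p")
    case True
    have "(\<Sum>t=q..<p. a ^ (p + q - 1 - t) * of_int (D i t)) = (\<Sum>t=q..<p. if t = p - 1 then of_int (D i t) else 0)"
      using True that by (intro sum.cong) (auto intro: D0)
    then show ?thesis using True by simp
  next
    case False
    then have "D i t = 0" if "t \<in> {q..<p}" for t
      using that \<open>p + q = _\<close> by (intro D0) auto
    then show ?thesis unfolding if_not_P[OF False] by simp
  qed
  have "dsmono (Suc ?n) m x = (\<Sum>i=1..?n.
    (\<Sum>t=m (Suc i)..<m i. a ^ (m i + m (Suc i) - 1 - t) * dsmono ?n ((del i m)(i := t)) x)
    - (\<Sum>t=m i..<m (Suc i). a ^ (m i + m (Suc i) - 1 - t) * dsmono ?n ((del i m)(i := t)) x))"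
    unfolding a_def using Suc.prems(3) by (intro dsmono_Suc) auto
  also have "\<dots> = (\<Sum>i=1..?n. of_int (Tsum k (Top i (pmono m))))"
  proof (rule sum.cong[OF refl])
    fix i assume i: "i \<in> {1..?n}"
    have "(\<Sum>t=m (Suc i)..<m i. a ^ (m i + m (Suc i) - 1 - t) * dsmono ?n ((del i m)(i := t)) x)
        = of_int (if m (Suc i) = 0 \<and> 0 < m i then D i (m i - 1) else 0)"
      by (subst S[symmetric]) (auto intro!: sum.cong simp: ds[OF i])
    moreover have "(\<Sum>t=m i..<m (Suc i). a ^ (m i + m (Suc i) - 1 - t) * dsmono ?n ((del i m)(i := t)) x)
        = of_int (if m i = 0 \<and> 0 < m (Suc i) then D i (m (Suc i) - 1) else 0)"
      by (subst S[symmetric]) (auto intro!: sum.cong simp: ds[OF i] add.commute)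
    moreover have "Tsum k (Top i (pmono m)) = (if m (Suc i) = 0 \<and> 0 < m i then D i (m i - 1) else 0)
        - (if m i = 0 \<and> 0 < m (Suc i) then D i (m (Suc i) - 1) else 0)"
      unfolding Top_pmono Tsum.diff D_def by (simp add: Tsum.zero)
    ultimately show "(\<Sum>t=m (Suc i)..<m i. a ^ (m i + m (Suc i) - 1 - t) * dsmono ?n ((del i m)(i := t)) x)
      - (\<Sum>t=m i..<m (Suc i). a ^ (m i + m (Suc i) - 1 - t) * dsmono ?n ((del i m)(i := t)) x)
      = of_int (Tsum k (Top i (pmono m)))"
      by (simp only: of_int_diff)
  qed
  also have "\<dots> = of_int (Tsum (Suc k) (pmono m))"
    by (simp only: Tsum.simps of_int_sum)
  finally show ?case .
qed

lemma Tsum_scale: "Tsum k (\<lambda>m. c * f m) = c * Tsum k f"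
proof (induction k arbitrary: f)
  case (Suc k)
  have "Top i (\<lambda>m. c * f m) = (\<lambda>m. c * Top i f m)" for i
    by (simp add: fun_eq_iff Top_def Rop_def right_diff_distrib)
  then show ?case by (simp add: Suc sum_distrib_left del: sum.cl_ivl_Suc)
qed simp

text \<open>Linear extension from monomials; bounded degree in k+1 variables makes the support
  finite.\<close>

lemma divsym_eq_Tsum:
  assumes v: "vars (Suc k) f" and d: "\<And>m. f m \<noteq> 0 \<Longrightarrow> mdeg m \<le> k" and x: "inj_on x {1..Suc k}"
  shows "divsym (Suc k) f x = of_int (Tsum k f)"
proof -
  let ?M = "{m. f m \<noteq> 0}"
  have supp: "m j \<noteq> 0 \<Longrightarrow> j \<in> {1..Suc k}" if "m \<in> ?M" for m j
    using v that unfolding vars_def by blast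
  have fin: "finite ?M"
  proof (rule finite_subset)
    show "?M \<subseteq> {m. \<forall>j. (j \<in> {1..Suc k} \<longrightarrow> m j \<in> {..k}) \<and> (j \<notin> {1..Suc k} \<longrightarrow> m j = 0)}"
    proof clarify
      fix m j assume m: "f m \<noteq> 0"
      have "mdeg m = (\<Sum>j=1..Suc k. m j)" using supp m by (intro mdeg_eq_sum) auto
      then have "m j \<le> k" if "j \<in> {1..Suc k}"
        using d[OF m] member_le_sum[OF that, of m] by simp
      then show "(j \<in> {1..Suc k} \<longrightarrow> m j \<in> {..k}) \<and> (j \<notin> {1..Suc k} \<longrightarrow> m j = 0)"
        using supp[of m j] m by auto
    qed
    show "finite {m. \<forall>j. (j \<in> {1..Suc k} \<longrightarrow> m j \<in> {..k}) \<and> (j \<notin> {1..Suc k} \<longrightarrow> m j = (0::nat))}"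
      by (rule finite_set_of_finite_funs) simp_all
  qed
  have "peval f y = (\<Sum>m\<in>?M. of_int (f m) * mval (Suc k) m y)" for y
    unfolding peval_def mval_def
  proof (rule sum.cong[OF refl])
    fix m assume "m \<in> ?M"
    then have "(\<Prod>j\<in>{j. m j \<noteq> 0}. y j ^ m j) = (\<Prod>j=1..Suc k. y j ^ m j)"
      using supp by (intro prod.mono_neutral_left) auto
    then show "of_int (f m) * (\<Prod>j\<in>{j. m j \<noteq> 0}. y j ^ m j) = of_int (f m) * (\<Prod>j=1..Suc k. y j ^ m j)"
      by simp
  qed
  then have "divsym (Suc k) f x = (\<Sum>\<sigma> | \<sigma> permutes {1..Suc k}. \<Sum>m\<in>?M.
      of_int (f m) * (mval (Suc k) m (x \<circ> \<sigma>) / dsden (Suc k) (x \<circ> \<sigma>)))"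
    unfolding divsym_def by (simp add: dsden_def sum_divide_distrib o_def)
  also have "\<dots> = (\<Sum>m\<in>?M. of_int (f m) * dsmono (Suc k) m x)"
    by (subst sum.swap) (simp only: dsmono_def sum_distrib_left)
  also have "\<dots> = (\<Sum>m\<in>?M. of_int (f m * Tsum k (pmono m)))"
    using supp d x by (intro sum.cong refl) (subst dsmono_eq_Tsum; auto)
  also have "\<dots> = of_int (\<Sum>m\<in>?M. Tsum k (\<lambda>m'. f m * pmono m m'))"
    by (simp only: Tsum_scale of_int_sum)
  also have "(\<Sum>m\<in>?M. Tsum k (\<lambda>m'. f m * pmono m m')) = Tsum k (\<Sum>m\<in>?M. (\<lambda>m'. f m * pmono m m'))"
    by (simp only: Tsum.sum)
  also have "(\<Sum>m\<in>?M. (\<lambda>m'. f m * pmono m m')) = f"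
  proof
    fix m'
    have "(\<Sum>m\<in>?M. (\<lambda>m'. f m * pmono m m')) m' = (\<Sum>m\<in>?M. if m = m' then f m else 0)"
      using fin by (induction rule: finite_induct) (auto simp: plus_fun_apply zero_fun_apply pmono_def)
    also have "\<dots> = f m'" using fin by (simp add: sum.delta)
    finally show "(\<Sum>m\<in>?M. (\<lambda>m'. f m * pmono m m')) m' = f m'" .
  qed
  finally show ?thesis .
qed

theorem mainTheorem19:
  fixes n :: nat and w :: "nat \<Rightarrow> nat"
  assumes "w permutes {1..n}" and "plength w + 1 = n"
  shows "(\<exists>is :: nat list. length is = n - 1 \<and> (\<forall>j < n - 1. 1 \<le> is ! j \<and> is ! j \<le> Suc j)
            \<and> foldr Top is (schubert w) (\<lambda>_. 0) > 0)
       \<and> (\<forall>x :: nat \<Rightarrow> real. inj_on x {1..n} \<longrightarrow> divsym n (schubert w) x > 0)"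
proof -
  obtain k where k: "n = Suc k" using assms(2) by (cases n) auto
  then have w: "w permutes {1..Suc k}" "plength w = k" using assms by simp_all
  \<comment> \<open>The list of extra factors is empty because the Schubert polynomial already has
    degree k.\<close>
  have pos: "Tsum k (schubert w) > 0" using Tsum_schubert_pos[of w k "[]"] w by simp
  have "divsym n (schubert w) x > 0" if "inj_on x {1..n}" for x
  proof -
    have "divsym (Suc k) (schubert w) x = of_int (Tsum k (schubert w))"
      using schubert(2,3)[OF w(1)] that w(2) unfolding k homog_def by (intro divsym_eq_Tsum) auto
    then show ?thesis using pos k by simp
  qed
  then show ?thesis using Tsum_pos_sequence[OF pos] k by simp
qed

end
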